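(* Suppose $C$ is a strict $3$-groupoid with an object $c$ such that $\pi_0(C)=\ast$, $\pi_1(C,c)=\{1\}$, $\pi_2(C,c)=\mathbf{Z}$ and $\pi_3(C,c)=H$ for an abelian group $H$. Then there exists a diagram of strict $3$-groupoids $$C \stackrel{g}{\leftarrow} B \stackrel{f}{\leftarrow} A \stackrel{h}{\rightarrow} D$$ with objects $b\in Ob(B)$, $a\in Ob(A)$, $d\in Ob(D)$ such that $f(a)=b$, $g(b)=c$, $h(a)=d$; such that $g$ and $f$ are equivalences of strict $3$-groupoids; such that $\pi_0(D)=\ast$, $\pi_1(D,d)=\{1\}$, $\pi_2(D,d)=\{0\}$; and such that $h$ induces an isomorphism $$\pi_3(h):\pi_3(A,a)=H\stackrel{\cong}{\rightarrow}\pi_3(D,d).$$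
   Context: **Strict $n$-categories.** A strict $0$-category is a set. For $n\ge 1$, a strict $n$-category is a category enriched over the cartesian category of strict $(n-1)$-categories: a set of objects $Ob(C)$, a strict $(n-1)$-category $Hom_C(x,y)$ for each pair of objects, strictly associative composition morphisms $Hom_C(x,y)\times Hom_C(y,z)\to Hom_C(x,z)$, and strict identities $1_x\in Ob(Hom_C(x,x))$. Morphisms strictly preserve all the structure. **Strict $n$-groupoids** (no strict inverses required). A strict $0$-groupoid is a set $A$, with $\pi_0(A)=A$. For $n\ge 1$, a strict $n$-category $A$ is a strict $n$-groupoid if every $Hom_A(x,y)$ is a strict $(n-1)$-groupoid and the category $\tau_{\le 1}A$, with the same objects as $A$ and with morphism sets $\pi_0(Hom_A(x,y))$, is a groupoid in the usual sense; then $\pi_0(A)$ is the set of isomorphism classes of $\tau_{\le 1}A$. Morphisms of strict $n$-groupoids are morphisms of strict $n$-categories. **Homotopy groups.** For a strict $n$-groupoid $A$ and $a\in Ob(A)$, $\pi_1(A,a)=\pi_0(Hom_A(a,a))$ and $\pi_i(A,a)=\pi_{i-1}(Hom_A(a,a),1_a)$ for $2\le i\le n$. The group structure comes from composition. Equivalently, $\pi_i(A,a)$ is the set of $i$-morphisms from the $(i-1)$-fold iterated identity of $a$ to itself, modulo the relation that two are joined by an $(i+1)$-morphism. **Equivalences.** A morphism $f:A\to B$ of strict $n$-groupoids is an equivalence if it induces a bijection $\pi_0(A)\to\pi_0(B)$ and, for every object $a\in A$ and every $1\le i\le n$, an isomorphism $\pi_i(A,a)\to\pi_i(B,f(a))$.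 The equality $\pi_3(A,a)=H$ is via the isomorphism $\pi_3(A,a)\cong\pi_3(C,c)=H$ induced by $gf$. Equalities such as $\pi_2(C,c)=\mathbf{Z}$ mean isomorphism of groups. *)

theory Defs
  imports "HOL-Algebra.Elementary_Groups"
begin

section \<open>Ordinary categories\<close>

text \<open>
  Composition is written in diagrammatic order throughout: \<open>cmp1 K x y z f g\<close> is the composite of
  \<open>f : x \<rightarrow> y\<close> with \<open>g : y \<rightarrow> z\<close>. Hom sets are indexed families and need not be disjoint.
\<close>

record ('o, 'm) cat1 =
  ob1 :: "'o set"
  hom1 :: "'o \<Rightarrow> 'o \<Rightarrow> 'm set"
  cmp1 :: "'o \<Rightarrow> 'o \<Rightarrow> 'o \<Rightarrow> 'm \<Rightarrow> 'm \<Rightarrow> 'm"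
  idn1 :: "'o \<Rightarrow> 'm"

definition category :: "('o, 'm) cat1 \<Rightarrow> bool" where
  "category K \<longleftrightarrow>
     (\<forall>x\<in>ob1 K. idn1 K x \<in> hom1 K x x) \<and>
     (\<forall>x\<in>ob1 K. \<forall>y\<in>ob1 K. \<forall>z\<in>ob1 K. \<forall>f\<in>hom1 K x y. \<forall>g\<in>hom1 K y z.
        cmp1 K x y z f g \<in> hom1 K x z) \<and>
     (\<forall>x\<in>ob1 K. \<forall>y\<in>ob1 K. \<forall>f\<in>hom1 K x y.
        cmp1 K x x y (idn1 K x) f = f \<and> cmp1 K x y y f (idn1 K y) = f) \<and>
     (\<forall>w\<in>ob1 K. \<forall>x\<in>ob1 K. \<forall>y\<in>ob1 K. \<forall>z\<in>ob1 K.
        \<forall>f\<in>hom1 K w x. \<forall>g\<in>hom1 K x y. \<forall>h\<in>hom1 K y z.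
        cmp1 K w y z (cmp1 K w x y f g) h = cmp1 K w x z f (cmp1 K x y z g h))"

definition inverse_arrows :: "('o, 'm) cat1 \<Rightarrow> 'o \<Rightarrow> 'o \<Rightarrow> 'm \<Rightarrow> 'm \<Rightarrow> bool" where
  "inverse_arrows K x y f g \<longleftrightarrow>
     f \<in> hom1 K x y \<and> g \<in> hom1 K y x \<and>
     cmp1 K x y x f g = idn1 K x \<and> cmp1 K y x y g f = idn1 K y"

definition groupoid :: "('o, 'm) cat1 \<Rightarrow> bool" where
  "groupoid K \<longleftrightarrow> category K \<and>
     (\<forall>x\<in>ob1 K. \<forall>y\<in>ob1 K. \<forall>f\<in>hom1 K x y. \<exists>g. inverse_arrows K x y f g)"

definition iso_rel :: "('o, 'm) cat1 \<Rightarrow> ('o \<times> 'o) set" where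
  "iso_rel K = {(x, y). x \<in> ob1 K \<and> y \<in> ob1 K \<and> (\<exists>f g. inverse_arrows K x y f g)}"


section \<open>Strict n-categories\<close>

text \<open>
  The two datatypes are the raw data of an \<open>n\<close>-category and of a morphism of \<open>n\<close>-categories,
  for all \<open>n\<close> at once; the axioms are imposed by \<open>strict_cat n\<close> and \<open>strict_functor n\<close> below, by
  recursion on the enrichment depth \<open>n\<close>. All levels of an \<open>n\<close>-category draw their cells from one
  type \<open>'u\<close>, which costs no generality since several types embed into their sum. Values outside
  the carriers \<open>ob\<close> are junk, so morphisms are compared by \<open>fun_eq\<close> instead of HOL equality.
\<close>

datatype ('a, 'b) nfun =
    is_map: MapFun (fob: "'a \<Rightarrow> 'b")
  | is_enr_fun: EnrFun (fob: "'a \<Rightarrow> 'b") (fhom: "'a \<Rightarrow> 'a \<Rightarrow> ('a, 'b) nfun")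

datatype 'u ncat =
    is_set: SetCat (ob: "'u set")
  | is_enr: EnrCat (ob: "'u set")
      (hom_cat: "'u \<Rightarrow> 'u \<Rightarrow> 'u ncat")
      (cmp: "'u \<Rightarrow> 'u \<Rightarrow> 'u \<Rightarrow> ('u \<times> 'u, 'u) nfun")
      (idn: "'u \<Rightarrow> 'u")

primrec fun_comp :: "nat \<Rightarrow> ('b, 'c) nfun \<Rightarrow> ('a, 'b) nfun \<Rightarrow> ('a, 'c) nfun" where
  "fun_comp 0 G F = MapFun (fob G \<circ> fob F)"
| "fun_comp (Suc n) G F =
     EnrFun (fob G \<circ> fob F) (\<lambda>x y. fun_comp n (fhom G (fob F x) (fob F y)) (fhom F x y))"

primrec fun_prod :: "nat \<Rightarrow> ('a, 'c) nfun \<Rightarrow> ('b, 'd) nfun \<Rightarrow> ('a \<times> 'b, 'c \<times> 'd) nfun" where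
  "fun_prod 0 F G = MapFun (map_prod (fob F) (fob G))"
| "fun_prod (Suc n) F G =
     EnrFun (map_prod (fob F) (fob G))
       (\<lambda>(x, x') (y, y'). fun_prod n (fhom F x y) (fhom G x' y'))"

text \<open>
  \<open>cellwise n \<phi>\<close> applies the same function to the cells of every dimension. As the cells of a
  product are pairs in every dimension, this yields the identity, the diagonal, the associator
  and the interchange of factors.
\<close>

primrec cellwise :: "nat \<Rightarrow> ('a \<Rightarrow> 'b) \<Rightarrow> ('a, 'b) nfun" where
  "cellwise 0 \<phi> = MapFun \<phi>"
| "cellwise (Suc n) \<phi> = EnrFun \<phi> (\<lambda>x y. cellwise n \<phi>)"

abbreviation fun_id :: "nat \<Rightarrow> ('a, 'a) nfun" where
  "fun_id n \<equiv> cellwise n (\<lambda>x. x)"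

text \<open>The constant morphism at an object \<open>c\<close>: higher cells go to the iterated identities of \<open>c\<close>.\<close>

primrec const_fun :: "nat \<Rightarrow> 'b ncat \<Rightarrow> 'b \<Rightarrow> ('a, 'b) nfun" where
  "const_fun 0 B c = MapFun (\<lambda>x. c)"
| "const_fun (Suc n) B c = EnrFun (\<lambda>x. c) (\<lambda>x y. const_fun n (hom_cat B c c) (idn B c))"

primrec prod_cat :: "nat \<Rightarrow> 'a ncat \<Rightarrow> 'b ncat \<Rightarrow> ('a \<times> 'b) ncat" where
  "prod_cat 0 A B = SetCat (ob A \<times> ob B)"
| "prod_cat (Suc n) A B =
     EnrCat (ob A \<times> ob B)
       (\<lambda>(x, x') (y, y'). prod_cat n (hom_cat A x y) (hom_cat B x' y'))
       (\<lambda>(x, x') (y, y') (z, z').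
          fun_comp n (fun_prod n (cmp A x y z) (cmp B x' y' z'))
            (cellwise n (\<lambda>((f, f'), (g, g')). ((f, g), (f', g')))))
       (\<lambda>(x, x'). (idn A x, idn B x'))"

text \<open>Equality of two morphisms with domain \<open>A\<close>.\<close>

primrec fun_eq :: "nat \<Rightarrow> 'a ncat \<Rightarrow> ('a, 'b) nfun \<Rightarrow> ('a, 'b) nfun \<Rightarrow> bool" where
  "fun_eq 0 A F G \<longleftrightarrow> (\<forall>x\<in>ob A. fob F x = fob G x)"
| "fun_eq (Suc n) A F G \<longleftrightarrow>
     (\<forall>x\<in>ob A. fob F x = fob G x) \<and>
     (\<forall>x\<in>ob A. \<forall>y\<in>ob A. fun_eq n (hom_cat A x y) (fhom F x y) (fhom G x y))"

primrec strict_functor :: "nat \<Rightarrow> 'a ncat \<Rightarrow> 'b ncat \<Rightarrow> ('a, 'b) nfun \<Rightarrow> bool" where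
  "strict_functor 0 A B F \<longleftrightarrow> is_map F \<and> (\<forall>x\<in>ob A. fob F x \<in> ob B)"
| "strict_functor (Suc n) A B F \<longleftrightarrow>
     is_enr_fun F \<and>
     (\<forall>x\<in>ob A. fob F x \<in> ob B) \<and>
     (\<forall>x\<in>ob A. \<forall>y\<in>ob A.
        strict_functor n (hom_cat A x y) (hom_cat B (fob F x) (fob F y)) (fhom F x y)) \<and>
     (\<forall>x\<in>ob A. fob (fhom F x x) (idn A x) = idn B (fob F x)) \<and>
     (\<forall>x\<in>ob A. \<forall>y\<in>ob A. \<forall>z\<in>ob A.
        fun_eq n (prod_cat n (hom_cat A x y) (hom_cat A y z))
          (fun_comp n (fhom F x z) (cmp A x y z))
          (fun_comp n (cmp B (fob F x) (fob F y) (fob F z))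
             (fun_prod n (fhom F x y) (fhom F y z))))"

primrec strict_cat :: "nat \<Rightarrow> 'u ncat \<Rightarrow> bool" where
  "strict_cat 0 A \<longleftrightarrow> is_set A"
| "strict_cat (Suc n) A \<longleftrightarrow>
     is_enr A \<and>
     (\<forall>x\<in>ob A. \<forall>y\<in>ob A. strict_cat n (hom_cat A x y)) \<and>
     (\<forall>x\<in>ob A. \<forall>y\<in>ob A. \<forall>z\<in>ob A.
        strict_functor n (prod_cat n (hom_cat A x y) (hom_cat A y z)) (hom_cat A x z)
          (cmp A x y z)) \<and>
     (\<forall>x\<in>ob A. idn A x \<in> ob (hom_cat A x x)) \<and>
     (\<forall>w\<in>ob A. \<forall>x\<in>ob A. \<forall>y\<in>ob A. \<forall>z\<in>ob A.
        fun_eq n (prod_cat n (prod_cat n (hom_cat A w x) (hom_cat A x y)) (hom_cat A y z))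
          (fun_comp n (cmp A w y z) (fun_prod n (cmp A w x y) (fun_id n)))
          (fun_comp n (cmp A w x z)
             (fun_comp n (fun_prod n (fun_id n) (cmp A x y z))
                (cellwise n (\<lambda>((f, g), h). (f, (g, h))))))) \<and>
     (\<forall>x\<in>ob A. \<forall>y\<in>ob A.
        fun_eq n (hom_cat A x y)
          (fun_comp n (cmp A x x y)
             (fun_comp n (fun_prod n (const_fun n (hom_cat A x x) (idn A x)) (fun_id n))
                (cellwise n (\<lambda>f. (f, f)))))
          (fun_id n) \<and>
        fun_eq n (hom_cat A x y)
          (fun_comp n (cmp A x y y)
             (fun_comp n (fun_prod n (fun_id n) (const_fun n (hom_cat A y y) (idn A y)))
                (cellwise n (\<lambda>f. (f, f)))))
          (fun_id n))"


section \<open>Strict n-groupoids and their homotopy groups\<close>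

text \<open>
  \<open>truncate R A\<close> has the objects of \<open>A\<close>, and its arrows are the classes of the objects of
  \<open>hom_cat A x y\<close> modulo the relation \<open>R (hom_cat A x y)\<close>. Composition of classes is defined by
  the union over representatives; it is a single class because the relations used below are
  congruences.
\<close>

definition truncate :: "('u ncat \<Rightarrow> ('u \<times> 'u) set) \<Rightarrow> 'u ncat \<Rightarrow> ('u, 'u set) cat1" where
  "truncate R A =
     \<lparr>ob1 = ob A,
      hom1 = (\<lambda>x y. ob (hom_cat A x y) // R (hom_cat A x y)),
      cmp1 = (\<lambda>x y z X Y. \<Union>f\<in>X. \<Union>g\<in>Y. R (hom_cat A x z) `` {fob (cmp A x y z) (f, g)}),
      idn1 = (\<lambda>x. R (hom_cat A x x) `` {idn A x})\<rparr>"

text \<open>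
  \<open>pi0_rel n A\<close> is the relation on objects whose classes form \<open>\<pi>\<^sub>0(A)\<close>: for \<open>n \<ge> 1\<close>, isomorphism
  in the truncation. For \<open>n = 0\<close> the elements of \<open>pi0 0 A\<close> are singletons instead of elements.
\<close>

primrec pi0_rel :: "nat \<Rightarrow> 'u ncat \<Rightarrow> ('u \<times> 'u) set" where
  "pi0_rel 0 A = Id_on (ob A)"
| "pi0_rel (Suc n) A = iso_rel (truncate (pi0_rel n) A)"

definition pi0 :: "nat \<Rightarrow> 'u ncat \<Rightarrow> 'u set set" where
  "pi0 n A = ob A // pi0_rel n A"

text \<open>The 1-truncation of a strict \<open>n\<close>-category \<open>A\<close>, for \<open>n \<ge> 1\<close>.\<close>

definition tau1 :: "nat \<Rightarrow> 'u ncat \<Rightarrow> ('u, 'u set) cat1" where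
  "tau1 n A = truncate (pi0_rel (n - 1)) A"

primrec strict_groupoid :: "nat \<Rightarrow> 'u ncat \<Rightarrow> bool" where
  "strict_groupoid 0 A \<longleftrightarrow> strict_cat 0 A"
| "strict_groupoid (Suc n) A \<longleftrightarrow>
     strict_cat (Suc n) A \<and>
     (\<forall>x\<in>ob A. \<forall>y\<in>ob A. strict_groupoid n (hom_cat A x y)) \<and>
     groupoid (tau1 (Suc n) A)"

text \<open>\<open>homotopy_group n i A a\<close> is \<open>\<pi>\<^sub>i(A, a)\<close> for an \<open>n\<close>-groupoid \<open>A\<close>, meaningful for \<open>1 \<le> i \<le> n\<close>.\<close>

fun homotopy_group :: "nat \<Rightarrow> nat \<Rightarrow> 'u ncat \<Rightarrow> 'u \<Rightarrow> 'u set monoid" where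
  "homotopy_group n (Suc 0) A a =
     \<lparr>carrier = pi0 (n - 1) (hom_cat A a a),
      monoid.mult = cmp1 (tau1 n A) a a a,
      one = idn1 (tau1 n A) a\<rparr>"
| "homotopy_group n (Suc (Suc i)) A a =
     homotopy_group (n - 1) (Suc i) (hom_cat A a a) (idn A a)"

definition pi0_map :: "nat \<Rightarrow> 'b ncat \<Rightarrow> ('a, 'b) nfun \<Rightarrow> 'a set \<Rightarrow> 'b set" where
  "pi0_map n B F X = (\<Union>x\<in>X. pi0_rel n B `` {fob F x})"

fun homotopy_map ::
  "nat \<Rightarrow> nat \<Rightarrow> 'a ncat \<Rightarrow> 'b ncat \<Rightarrow> ('a, 'b) nfun \<Rightarrow> 'a \<Rightarrow> 'a set \<Rightarrow> 'b set" where
  "homotopy_map n (Suc 0) A B F a =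
     pi0_map (n - 1) (hom_cat B (fob F a) (fob F a)) (fhom F a a)"
| "homotopy_map n (Suc (Suc i)) A B F a =
     homotopy_map (n - 1) (Suc i) (hom_cat A a a) (hom_cat B (fob F a) (fob F a))
       (fhom F a a) (idn A a)"

definition strict_equivalence :: "nat \<Rightarrow> 'a ncat \<Rightarrow> 'b ncat \<Rightarrow> ('a, 'b) nfun \<Rightarrow> bool" where
  "strict_equivalence n A B F \<longleftrightarrow>
     strict_functor n A B F \<and>
     bij_betw (pi0_map n B F) (pi0 n A) (pi0 n B) \<and>
     (\<forall>a\<in>ob A. \<forall>i\<in>{1..n}.
        homotopy_map n i A B F a \<in> iso (homotopy_group n i A a) (homotopy_group n i B (fob F a)))"

end

theory Submission
  imports Defs "HOL-Library.Nat_Bijection"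
begin

text \<open>
  The 2- and 3-cells of \<open>C\<close> over \<open>1\<^sub>c\<close> form a category \<open>M\<close> with two compatible strict
  multiplications and a common unit, so by Eckmann and Hilton a strictly commutative monoidal
  category. Choose objects \<open>x\<close>, \<open>y\<close> of \<open>M\<close> that represent \<open>1\<close> and \<open>-1\<close> in \<open>\<pi>\<^sub>2(C, c) = \<int>\<close>, and let
  \<open>A\<close> be the double delooping of the category with objects \<open>(m, n) \<in> \<nat> \<times> \<nat>\<close> and arrows
  \<open>m x + n y \<rightarrow> m' x + n' y\<close> of \<open>M\<close>; it maps to \<open>C\<close> by an equivalence, which we take for \<open>g\<close>, with
  \<open>B = A\<close> and \<open>f\<close> the identity. An isomorphism \<open>0 \<cong> x + y\<close> determines compatible isomorphisms
  \<open>0 \<cong> k (x + y)\<close>. Adding a suitable object to the two ends of an arrow \<open>(m, n) \<rightarrow> (m', n')\<close>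
  makes them multiples of \<open>x + y\<close>, so the arrow becomes an endomorphism of \<open>0\<close>. This is a strict
  monoidal functor onto \<open>End(0) = \<pi>\<^sub>3(C, c)\<close>, and \<open>h\<close> is its double delooping.
\<close>

section \<open>Homotopy groups and identity morphisms\<close>

lemma equiv_iso_rel:
  assumes "category K"
  shows "equiv (ob1 K) (iso_rel K)"
proof (rule equivI)
  show "iso_rel K \<subseteq> ob1 K \<times> ob1 K"
    by (auto simp: iso_rel_def)
  show "refl_on (ob1 K) (iso_rel K)"
    using assms by (fastforce simp: refl_on_def iso_rel_def inverse_arrows_def category_def)
  show "sym (iso_rel K)"
    by (auto simp: sym_def iso_rel_def inverse_arrows_def)
  show "trans (iso_rel K)"
  proof (rule transI)
    fix x y z
    assume "(x, y) \<in> iso_rel K" "(y, z) \<in> iso_rel K"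
    then obtain f g f' g' where xyz: "x \<in> ob1 K" "y \<in> ob1 K" "z \<in> ob1 K"
      and f: "f \<in> hom1 K x y" and g: "g \<in> hom1 K y x"
      and f': "f' \<in> hom1 K y z" and g': "g' \<in> hom1 K z y"
      and eqs: "cmp1 K x y x f g = idn1 K x" "cmp1 K y x y g f = idn1 K y"
        "cmp1 K y z y f' g' = idn1 K y" "cmp1 K z y z g' f' = idn1 K z"
      by (auto simp: iso_rel_def inverse_arrows_def)
    have cl: "\<And>x y z f g. \<lbrakk>x \<in> ob1 K; y \<in> ob1 K; z \<in> ob1 K; f \<in> hom1 K x y; g \<in> hom1 K y z\<rbrakk>
        \<Longrightarrow> cmp1 K x y z f g \<in> hom1 K x z"
      and un: "\<And>x y f. \<lbrakk>x \<in> ob1 K; y \<in> ob1 K; f \<in> hom1 K x y\<rbrakk> \<Longrightarrow> cmp1 K x x y (idn1 K x) f = f"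
      and as: "\<And>w x y z f g h. \<lbrakk>w \<in> ob1 K; x \<in> ob1 K; y \<in> ob1 K; z \<in> ob1 K;
          f \<in> hom1 K w x; g \<in> hom1 K x y; h \<in> hom1 K y z\<rbrakk>
        \<Longrightarrow> cmp1 K w y z (cmp1 K w x y f g) h = cmp1 K w x z f (cmp1 K x y z g h)"
      using assms unfolding category_def by blast+
    have "cmp1 K x z x (cmp1 K x y z f f') (cmp1 K z y x g' g) = idn1 K x"
      using as[of x y z x f f' "cmp1 K z y x g' g"] as[of y z y x f' g' g] xyz f g f' g' eqs cl un
      by simp
    moreover have "cmp1 K z x z (cmp1 K z y x g' g) (cmp1 K x y z f f') = idn1 K z"
      using as[of z y x z g' g "cmp1 K x y z f f'"] as[of y x y z g f f'] xyz f g f' g' eqs cl un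
      by simp
    ultimately show "(x, z) \<in> iso_rel K"
      using xyz f g f' g' cl unfolding iso_rel_def inverse_arrows_def by blast
  qed
qed

lemma equiv_pi0_rel:
  assumes "strict_groupoid n A"
  shows "equiv (ob A) (pi0_rel n A)"
proof (cases n)
  case 0
  then show ?thesis
    by (simp add: equiv_def refl_on_def sym_def trans_def Id_on_def) blast
next
  case (Suc k)
  then have "category (truncate (pi0_rel k) A)"
    using assms by (simp add: tau1_def groupoid_def)
  from equiv_iso_rel[OF this] show ?thesis
    using Suc by (simp add: truncate_def)
qed

text \<open>This is the automorphism group of \<open>a\<close> in the 1-truncation, with the
  inverses of the groupoid \<open>tau1\<close>.\<close>

lemma homotopy_group_1_group:
  assumes "groupoid (tau1 (Suc n) A)" and a: "a \<in> ob A"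
  shows "group (homotopy_group (Suc n) 1 A a)"
proof -
  let ?K = "tau1 (Suc n) A"
  have K: "category ?K"
    and inv: "\<And>f. f \<in> hom1 ?K a a \<Longrightarrow> \<exists>g. inverse_arrows ?K a a f g"
    using assms by (auto simp: groupoid_def tau1_def truncate_def)
  have ob: "a \<in> ob1 ?K" and car: "pi0 n (hom_cat A a a) = hom1 ?K a a"
    using a by (auto simp: tau1_def truncate_def pi0_def)
  show ?thesis
  proof (rule groupI, goal_cases)
    case (5 f)
    then show ?case
      using inv by (fastforce simp: car inverse_arrows_def)
  qed (use K ob in \<open>auto simp: car category_def\<close>)
qed

text \<open>The recursion passes to hom groupoids until index 1, where the automorphism group of an
  object remains.\<close>

lemma homotopy_group_group:
  "\<lbrakk>strict_groupoid n A; a \<in> ob A; 1 \<le> i; i \<le> n\<rbrakk> \<Longrightarrow> group (homotopy_group n i A a)"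
proof (induction n i A a rule: homotopy_group.induct)
  case (1 n A a)
  then show ?case
    using homotopy_group_1_group[of "n - 1" A a] by (cases n) auto
next
  case (2 n i A a)
  then show ?case
    by (cases n) auto
qed simp

lemma strict_groupoid_imp_cat: "strict_groupoid n A \<Longrightarrow> strict_cat n A"
  by (cases n) auto

text \<open>Both sides act as \<open>F\<close> on all cells; this is the condition on composition
  that the identity morphism has to meet.\<close>

lemma fun_eq_comp_id:
  "fun_eq n X (fun_comp n (fun_id n) F) (fun_comp n F (fun_prod n (fun_id n) (fun_id n)))"
  by (induction n arbitrary: X F) auto

lemma fob_id [simp]: "fob (fun_id n) = (\<lambda>x. x)"
  by (cases n) auto

lemma strict_functor_id: "strict_cat n A \<Longrightarrow> strict_functor n A A (fun_id n)"
  by (induction n arbitrary: A) (auto simp: fun_eq_comp_id)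

lemma pi0_map_id:
  assumes "strict_groupoid n A" and "X \<in> pi0 n A"
  shows "pi0_map n A (fun_id n) X = X"
proof -
  have eq: "equiv (ob A) (pi0_rel n A)"
    using assms(1) by (rule equiv_pi0_rel)
  obtain x where "x \<in> ob A" "X = pi0_rel n A `` {x}"
    using assms(2) by (auto simp: pi0_def elim: quotientE)
  then show ?thesis
    unfolding pi0_map_def fob_id
    using equiv_class_self[OF eq] equiv_class_eq[OF eq] by blast
qed

lemma homotopy_map_id:
  "\<lbrakk>strict_groupoid n A; a \<in> ob A; 1 \<le> i; i \<le> n; X \<in> carrier (homotopy_group n i A a)\<rbrakk>
    \<Longrightarrow> homotopy_map n i A A (fun_id n) a X = X"
proof (induction n i A a arbitrary: X rule: homotopy_group.induct)
  case (1 n A a)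
  then obtain k where "n = Suc k" by (cases n) auto
  with 1 show ?case by (simp add: pi0_map_id)
next
  case (2 n i A a)
  then obtain k where "n = Suc k" by (cases n) auto
  with 2 show ?case by simp
qed simp

lemma strict_equivalence_id:
  assumes A: "strict_groupoid n A"
  shows "strict_equivalence n A A (fun_id n)"
  unfolding strict_equivalence_def
proof (intro conjI ballI)
  show "strict_functor n A A (fun_id n)"
    using A by (simp add: strict_functor_id strict_groupoid_imp_cat)
  show "bij_betw (pi0_map n A (fun_id n)) (pi0 n A) (pi0 n A)"
    \<comment> \<open>\<open>pi0_map_id\<close> speaks of the classes in \<open>pi0 n A\<close>
      only, so the inverse is exhibited on these.\<close>
    by (rule bij_betw_byWitness[where f' = "\<lambda>X. X"]) (auto simp: pi0_map_id[OF A])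
  fix a i
  assume a: "a \<in> ob A" and i: "i \<in> {1..n}"
  let ?G = "homotopy_group n i A a"
  have G: "group ?G"
    using A a i by (intro homotopy_group_group) auto
  have map: "\<And>X. X \<in> carrier ?G \<Longrightarrow> homotopy_map n i A A (fun_id n) a X = X"
    using A a i by (intro homotopy_map_id) auto
  have "bij_betw (homotopy_map n i A A (fun_id n) a) (carrier ?G) (carrier ?G)"
    by (rule bij_betw_byWitness[where f' = "\<lambda>X. X"]) (auto simp: map)
  moreover have "homotopy_map n i A A (fun_id n) a \<in> hom ?G ?G"
    using group.is_monoid[OF G, THEN monoid.m_closed] by (simp add: hom_def map)
  ultimately have "homotopy_map n i A A (fun_id n) a \<in> iso ?G ?G"
    by (simp add: iso_def)
  then show "homotopy_map n i A A (fun_id n) a \<in> iso ?G (homotopy_group n i A (fob (fun_id n) a))"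
    by simp
qed

section \<open>Strictly commutative monoidal categories\<close>

text \<open>Hom sets may overlap, so the operations on arrows carry the objects at the ends as
  arguments.\<close>

record ('o, 'm) moncat =
  Obj :: "'o set"
  Hom :: "'o \<Rightarrow> 'o \<Rightarrow> 'm set"
  Comp :: "'o \<Rightarrow> 'o \<Rightarrow> 'o \<Rightarrow> 'm \<Rightarrow> 'm \<Rightarrow> 'm"
  Id :: "'o \<Rightarrow> 'm"
  Add :: "'o \<Rightarrow> 'o \<Rightarrow> 'o"
  Zero :: "'o"
  Addh :: "'o \<Rightarrow> 'o \<Rightarrow> 'o \<Rightarrow> 'o \<Rightarrow> 'm \<Rightarrow> 'm \<Rightarrow> 'm"

definition inverse_homs :: "('o, 'm) moncat \<Rightarrow> 'o \<Rightarrow> 'o \<Rightarrow> 'm \<Rightarrow> 'm \<Rightarrow> bool" where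
  "inverse_homs M u v f g \<longleftrightarrow> f \<in> Hom M u v \<and> g \<in> Hom M v u \<and>
     Comp M u v u f g = Id M u \<and> Comp M v u v g f = Id M v"

definition isom_rel :: "('o, 'm) moncat \<Rightarrow> ('o \<times> 'o) set" where
  "isom_rel M = {(u, v). u \<in> Obj M \<and> v \<in> Obj M \<and> (\<exists>f g. inverse_homs M u v f g)}"

text \<open>For \<open>f : u \<rightarrow> v\<close> and \<open>g : u' \<rightarrow> v'\<close>, the sum \<open>Addh M u u' v v' f g\<close> goes from \<open>u + u'\<close> to \<open>v + v'\<close>.\<close>

locale comm_moncat =
  fixes M :: "('o, 'm) moncat"
  assumes Id_in [simp, intro]: "u \<in> Obj M \<Longrightarrow> Id M u \<in> Hom M u u"
    and Comp_in [simp, intro]: "\<lbrakk>u \<in> Obj M; v \<in> Obj M; w \<in> Obj M; f \<in> Hom M u v; g \<in> Hom M v w\<rbrakk>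
      \<Longrightarrow> Comp M u v w f g \<in> Hom M u w"
    and Comp_Id_left [simp]: "\<lbrakk>u \<in> Obj M; v \<in> Obj M; f \<in> Hom M u v\<rbrakk> \<Longrightarrow> Comp M u u v (Id M u) f = f"
    and Comp_Id_right [simp]: "\<lbrakk>u \<in> Obj M; v \<in> Obj M; f \<in> Hom M u v\<rbrakk> \<Longrightarrow> Comp M u v v f (Id M v) = f"
    and Comp_assoc: "\<lbrakk>t \<in> Obj M; u \<in> Obj M; v \<in> Obj M; w \<in> Obj M;
        f \<in> Hom M t u; g \<in> Hom M u v; h \<in> Hom M v w\<rbrakk>
      \<Longrightarrow> Comp M t v w (Comp M t u v f g) h = Comp M t u w f (Comp M u v w g h)"
    and Zero_in [simp, intro]: "Zero M \<in> Obj M"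
    and Add_in [simp, intro]: "\<lbrakk>u \<in> Obj M; v \<in> Obj M\<rbrakk> \<Longrightarrow> Add M u v \<in> Obj M"
    and Add_assoc: "\<lbrakk>u \<in> Obj M; v \<in> Obj M; w \<in> Obj M\<rbrakk> \<Longrightarrow> Add M (Add M u v) w = Add M u (Add M v w)"
    and Add_comm: "\<lbrakk>u \<in> Obj M; v \<in> Obj M\<rbrakk> \<Longrightarrow> Add M u v = Add M v u"
    and Add_Zero [simp]: "u \<in> Obj M \<Longrightarrow> Add M (Zero M) u = u"
    and Addh_in [simp, intro]: "\<lbrakk>u \<in> Obj M; u' \<in> Obj M; v \<in> Obj M; v' \<in> Obj M;
        f \<in> Hom M u v; g \<in> Hom M u' v'\<rbrakk>
      \<Longrightarrow> Addh M u u' v v' f g \<in> Hom M (Add M u u') (Add M v v')"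
    and Addh_assoc: "\<lbrakk>u \<in> Obj M; v \<in> Obj M; w \<in> Obj M; u' \<in> Obj M; v' \<in> Obj M; w' \<in> Obj M;
        f \<in> Hom M u u'; g \<in> Hom M v v'; h \<in> Hom M w w'\<rbrakk>
      \<Longrightarrow> Addh M (Add M u v) w (Add M u' v') w' (Addh M u v u' v' f g) h =
          Addh M u (Add M v w) u' (Add M v' w') f (Addh M v w v' w' g h)"
    and Addh_comm: "\<lbrakk>u \<in> Obj M; u' \<in> Obj M; v \<in> Obj M; v' \<in> Obj M; f \<in> Hom M u v; g \<in> Hom M u' v'\<rbrakk>
      \<Longrightarrow> Addh M u u' v v' f g = Addh M u' u v' v g f"
    and Addh_Zero [simp]: "\<lbrakk>u \<in> Obj M; v \<in> Obj M; f \<in> Hom M u v\<rbrakk>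
      \<Longrightarrow> Addh M (Zero M) u (Zero M) v (Id M (Zero M)) f = f"
    and Addh_Id: "\<lbrakk>u \<in> Obj M; v \<in> Obj M\<rbrakk> \<Longrightarrow> Addh M u v u v (Id M u) (Id M v) = Id M (Add M u v)"
    and interchange: "\<lbrakk>u \<in> Obj M; v \<in> Obj M; w \<in> Obj M; u' \<in> Obj M; v' \<in> Obj M; w' \<in> Obj M;
        f \<in> Hom M u v; g \<in> Hom M v w; f' \<in> Hom M u' v'; g' \<in> Hom M v' w'\<rbrakk>
      \<Longrightarrow> Comp M (Add M u u') (Add M v v') (Add M w w') (Addh M u u' v v' f f') (Addh M v v' w w' g g') =
          Addh M u u' w w' (Comp M u v w f g) (Comp M u' v' w' f' g')"
begin

lemma Add_Zero_right [simp]: "u \<in> Obj M \<Longrightarrow> Add M u (Zero M) = u"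
  using Add_comm[of u "Zero M"] by simp

lemma Addh_Zero_right [simp]: "\<lbrakk>u \<in> Obj M; v \<in> Obj M; f \<in> Hom M u v\<rbrakk>
    \<Longrightarrow> Addh M u (Zero M) v (Zero M) f (Id M (Zero M)) = f"
  using Addh_comm[of u "Zero M" v "Zero M" f "Id M (Zero M)"] by simp

lemma Add_left_comm: "\<lbrakk>u \<in> Obj M; v \<in> Obj M; w \<in> Obj M\<rbrakk> \<Longrightarrow> Add M u (Add M v w) = Add M v (Add M u w)"
  by (metis Add_assoc Add_comm)

lemma Add_middle: "\<lbrakk>s \<in> Obj M; t \<in> Obj M; u \<in> Obj M; v \<in> Obj M\<rbrakk>
    \<Longrightarrow> Add M (Add M s t) (Add M u v) = Add M (Add M s u) (Add M t v)"
  by (simp add: Add_assoc Add_left_comm)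

text \<open>Regroup around the two middle summands and exchange them. The ends of the arrows change
  with the arrows, so \<open>Add_comm\<close> has to accompany \<open>Addh_comm\<close>.\<close>

lemma Addh_middle:
  assumes "s \<in> Obj M" "t \<in> Obj M" "u \<in> Obj M" "v \<in> Obj M"
    and "s' \<in> Obj M" "t' \<in> Obj M" "u' \<in> Obj M" "v' \<in> Obj M"
    and "e \<in> Hom M s s'" "f \<in> Hom M t t'" "g \<in> Hom M u u'" "h \<in> Hom M v v'"
  shows "Addh M (Add M s t) (Add M u v) (Add M s' t') (Add M u' v')
            (Addh M s t s' t' e f) (Addh M u v u' v' g h) =
         Addh M (Add M s u) (Add M t v) (Add M s' u') (Add M t' v')
            (Addh M s u s' u' e g) (Addh M t v t' v' f h)"
proof -
  have "Addh M t (Add M u v) t' (Add M u' v') f (Addh M u v u' v' g h) =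
        Addh M (Add M t u) v (Add M t' u') v' (Addh M t u t' u' f g) h"
    using assms by (simp add: Addh_assoc)
  also have "\<dots> = Addh M (Add M u t) v (Add M u' t') v' (Addh M u t u' t' g f) h"
    using assms Addh_comm[of t u t' u' f g] Add_comm[of t u] Add_comm[of t' u'] by simp
  also have "\<dots> = Addh M u (Add M t v) u' (Add M t' v') g (Addh M t v t' v' f h)"
    using assms by (simp add: Addh_assoc)
  finally show ?thesis
    using assms Add_left_comm[of t u v] Add_left_comm[of t' u' v']
    by (simp add: Addh_assoc)
qed

text \<open>Eckmann--Hilton.\<close>

lemma Addh_Zero_Zero:
  assumes "f \<in> Hom M (Zero M) (Zero M)" "g \<in> Hom M (Zero M) (Zero M)"
  shows "Addh M (Zero M) (Zero M) (Zero M) (Zero M) f g = Comp M (Zero M) (Zero M) (Zero M) f g"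
  using interchange[of "Zero M" "Zero M" "Zero M" "Zero M" "Zero M" "Zero M"
      f "Id M (Zero M)" "Id M (Zero M)" g] assms
  by simp

section \<open>Isomorphism classes of objects, and multiples of an object\<close>

lemma equiv_isom_rel: "equiv (Obj M) (isom_rel M)"
proof -
  let ?K = "\<lparr>ob1 = Obj M, hom1 = Hom M, cmp1 = Comp M, idn1 = Id M\<rparr>"
  have "category ?K"
    by (auto simp: category_def Comp_assoc)
  from equiv_iso_rel[OF this] show ?thesis
    by (simp add: iso_rel_def inverse_arrows_def isom_rel_def inverse_homs_def)
qed

lemma inverse_homs_Add:
  assumes "inverse_homs M u v f g" "inverse_homs M u' v' f' g'"
    and "u \<in> Obj M" "v \<in> Obj M" "u' \<in> Obj M" "v' \<in> Obj M"
  shows "inverse_homs M (Add M u u') (Add M v v') (Addh M u u' v v' f f') (Addh M v v' u u' g g')"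
  using assms by (simp add: inverse_homs_def interchange Addh_Id)

lemma isom_rel_Add:
  "\<lbrakk>(u, v) \<in> isom_rel M; (u', v') \<in> isom_rel M\<rbrakk> \<Longrightarrow> (Add M u u', Add M v v') \<in> isom_rel M"
  using inverse_homs_Add unfolding isom_rel_def by blast

text \<open>The product in \<open>pi2\<close> ranges over all representatives, as in
  \<open>truncate\<close>; since isomorphism is a congruence for sums, they all give one
  class.\<close>

lemma UN_class_Add:
  assumes "u \<in> Obj M" "v \<in> Obj M"
  shows "(\<Union>x\<in>isom_rel M `` {u}. \<Union>y\<in>isom_rel M `` {v}. isom_rel M `` {Add M x y})
      = isom_rel M `` {Add M u v}"
proof -
  have "isom_rel M `` {Add M x y} = isom_rel M `` {Add M u v}"
    if "x \<in> isom_rel M `` {u}" "y \<in> isom_rel M `` {v}" for x y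
    using that isom_rel_Add equiv_class_eq[OF equiv_isom_rel] by (metis Image_singleton_iff)
  moreover have "u \<in> isom_rel M `` {u}" "v \<in> isom_rel M `` {v}"
    using assms equiv_class_self[OF equiv_isom_rel] by auto
  ultimately show ?thesis by blast
qed

primrec mult :: "nat \<Rightarrow> 'o \<Rightarrow> 'o" where
  "mult 0 u = Zero M"
| "mult (Suc n) u = Add M u (mult n u)"

lemma mult_in [simp, intro]: "u \<in> Obj M \<Longrightarrow> mult n u \<in> Obj M"
  by (induction n) auto

lemma mult_add: "u \<in> Obj M \<Longrightarrow> mult (m + n) u = Add M (mult m u) (mult n u)"
  by (induction m) (auto simp: Add_assoc)

lemma mult_Add: "\<lbrakk>u \<in> Obj M; v \<in> Obj M\<rbrakk> \<Longrightarrow> mult n (Add M u v) = Add M (mult n u) (mult n v)"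
  by (induction n) (auto simp: Add_middle)

end

text \<open>
  Different \<open>(m, n)\<close> may give the same object \<open>m x + n y\<close> of \<open>M\<close>, so everything below is indexed by
  \<open>(m, n)\<close> and not by objects.
\<close>

locale weak_inverse_pair = comm_moncat M for M :: "('o, 'm) moncat" +
  fixes x y :: 'o and \<phi> \<psi> :: 'm
  assumes x [simp, intro]: "x \<in> Obj M" and y [simp, intro]: "y \<in> Obj M"
    and inverse_\<phi>\<psi>: "inverse_homs M (Zero M) (Add M x y) \<phi> \<psi>"
begin

fun val :: "nat \<times> nat \<Rightarrow> 'o" where
  "val (m, n) = Add M (mult m x) (mult n y)"

abbreviation padd :: "nat \<times> nat \<Rightarrow> nat \<times> nat \<Rightarrow> nat \<times> nat" where
  "padd p q \<equiv> (fst p + fst q, snd p + snd q)"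

lemma val_in [simp, intro]: "val p \<in> Obj M"
  by (cases p) auto

lemma val_padd: "val (padd p q) = Add M (val p) (val q)"
  by (cases p; cases q) (simp add: mult_add Add_middle)

lemma val_plus: "val (a + c, b + d) = Add M (val (a, b)) (val (c, d))"
  using val_padd[of "(a, b)" "(c, d)"] by simp

lemma val_zero [simp]: "val (0, 0) = Zero M"
  by simp

abbreviation diag :: "nat \<Rightarrow> 'o" where
  "diag k \<equiv> mult k (Add M x y)"

lemma val_diag: "val (k, k) = diag k"
  by (simp add: mult_Add)

text \<open>Iterated sums of \<open>\<phi>\<close>; the source stays \<open>0\<close> because
  \<open>0 + 0 = 0\<close> holds strictly.\<close>

primrec push :: "nat \<Rightarrow> 'm" where
  "push 0 = Id M (Zero M)"
| "push (Suc k) = Addh M (Zero M) (Zero M) (Add M x y) (diag k) \<phi> (push k)"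

primrec pull :: "nat \<Rightarrow> 'm" where
  "pull 0 = Id M (Zero M)"
| "pull (Suc k) = Addh M (Add M x y) (diag k) (Zero M) (Zero M) \<psi> (pull k)"

lemma inverse_push_pull: "inverse_homs M (Zero M) (diag k) (push k) (pull k)"
proof (induction k)
  case 0
  then show ?case by (simp add: inverse_homs_def)
next
  case (Suc k)
  with inverse_homs_Add[OF inverse_\<phi>\<psi> this] show ?case by simp
qed

lemma push_in [simp, intro]: "push k \<in> Hom M (Zero M) (diag k)"
  and pull_in [simp, intro]: "pull k \<in> Hom M (diag k) (Zero M)"
  and push_pull [simp]: "Comp M (Zero M) (diag k) (Zero M) (push k) (pull k) = Id M (Zero M)"
  and pull_push [simp]: "Comp M (diag k) (Zero M) (diag k) (pull k) (push k) = Id M (diag k)"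
  using inverse_push_pull[of k] by (auto simp: inverse_homs_def)

lemma \<phi>_in [simp, intro]: "\<phi> \<in> Hom M (Zero M) (Add M x y)"
  and \<psi>_in [simp, intro]: "\<psi> \<in> Hom M (Add M x y) (Zero M)"
  using inverse_\<phi>\<psi> by (auto simp: inverse_homs_def)

lemma push_add: "push (j + k) = Addh M (Zero M) (Zero M) (diag j) (diag k) (push j) (push k)"
proof (induction j)
  case (Suc j)
  \<comment> \<open>The ends \<open>0 + 0\<close> are left unreduced here so that
    \<open>Addh_assoc\<close> matches; the simplifier removes them afterwards.\<close>
  have "Addh M (Add M (Zero M) (Zero M)) (Zero M) (Add M (Add M x y) (diag j)) (diag k)
          (Addh M (Zero M) (Zero M) (Add M x y) (diag j) \<phi> (push j)) (push k) =
        Addh M (Zero M) (Add M (Zero M) (Zero M)) (Add M x y) (Add M (diag j) (diag k)) \<phi>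
          (Addh M (Zero M) (Zero M) (diag j) (diag k) (push j) (push k))"
    by (intro Addh_assoc) auto
  with Suc show ?case by (simp add: mult_add)
qed auto

lemma pull_add: "pull (j + k) = Addh M (diag j) (diag k) (Zero M) (Zero M) (pull j) (pull k)"
proof (induction j)
  case (Suc j)
  have "Addh M (Add M (Add M x y) (diag j)) (diag k) (Add M (Zero M) (Zero M)) (Zero M)
          (Addh M (Add M x y) (diag j) (Zero M) (Zero M) \<psi> (pull j)) (pull k) =
        Addh M (Add M x y) (Add M (diag j) (diag k)) (Zero M) (Add M (Zero M) (Zero M)) \<psi>
          (Addh M (diag j) (diag k) (Zero M) (Zero M) (pull j) (pull k))"
    by (intro Addh_assoc) auto
  with Suc show ?case by (simp add: mult_add)
qed auto

section \<open>Arrows between multiples of \<open>x + y\<close> as endomorphisms of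
  \<open>0\<close>\<close>

abbreviation loop :: "nat \<Rightarrow> nat \<Rightarrow> 'm \<Rightarrow> 'm" where
  "loop k l f \<equiv>
     Comp M (Zero M) (diag l) (Zero M) (Comp M (Zero M) (diag k) (diag l) (push k) f) (pull l)"

lemma loop_in: "f \<in> Hom M (diag k) (diag l) \<Longrightarrow> loop k l f \<in> Hom M (Zero M) (Zero M)"
  by (intro Comp_in) auto

text \<open>In the composite of the two loops \<open>pull k\<close> meets \<open>push k\<close>, and
  they cancel.\<close>

lemma loop_Comp:
  assumes f: "f \<in> Hom M (diag j) (diag k)" and g: "g \<in> Hom M (diag k) (diag l)"
  shows "loop j l (Comp M (diag j) (diag k) (diag l) f g)
      = Comp M (Zero M) (Zero M) (Zero M) (loop j k f) (loop k l g)"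
proof -
  let ?z = "Zero M" and ?C = "Comp M"
  let ?pf = "?C ?z (diag j) (diag k) (push j) f"
  let ?gq = "?C (diag k) (diag l) ?z g (pull l)"
  have pf: "?pf \<in> Hom M ?z (diag k)" and gq: "?gq \<in> Hom M (diag k) ?z"
    using f g by (auto intro!: Comp_in)
  have "?C ?z ?z ?z (loop j k f) (loop k l g) =
      ?C ?z (diag k) ?z ?pf (?C (diag k) ?z ?z (pull k) (?C ?z (diag k) ?z (push k) ?gq))"
    using f g pf gq by (simp add: Comp_assoc)
  also have "?C (diag k) ?z ?z (pull k) (?C ?z (diag k) ?z (push k) ?gq) = ?gq"
    using Comp_assoc[of "diag k" ?z "diag k" ?z "pull k" "push k" ?gq] gq by simp
  finally show ?thesis
    using f g by (simp add: Comp_assoc)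
qed

text \<open>As \<open>push\<close> and \<open>pull\<close> at a sum of indices are themselves sums,
  two uses of interchange split the whole composite.\<close>

lemma loop_Addh:
  assumes f: "f \<in> Hom M (diag j) (diag k)" and f': "f' \<in> Hom M (diag j') (diag k')"
  shows "loop (j + j') (k + k') (Addh M (diag j) (diag j') (diag k) (diag k') f f') =
    Addh M (Zero M) (Zero M) (Zero M) (Zero M) (loop j k f) (loop j' k' f')"
proof -
  let ?z = "Zero M" and ?C = "Comp M"
  have 1: "?C (Add M ?z ?z) (Add M (diag j) (diag j')) (Add M (diag k) (diag k'))
        (Addh M ?z ?z (diag j) (diag j') (push j) (push j'))
        (Addh M (diag j) (diag j') (diag k) (diag k') f f') =
      Addh M ?z ?z (diag k) (diag k')
        (?C ?z (diag j) (diag k) (push j) f) (?C ?z (diag j') (diag k') (push j') f')"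
    using f f' by (intro interchange) auto
  have 2: "?C (Add M ?z ?z) (Add M (diag k) (diag k')) (Add M ?z ?z)
        (Addh M ?z ?z (diag k) (diag k')
          (?C ?z (diag j) (diag k) (push j) f) (?C ?z (diag j') (diag k') (push j') f'))
        (Addh M (diag k) (diag k') ?z ?z (pull k) (pull k')) =
      Addh M ?z ?z ?z ?z (loop j k f) (loop j' k' f')"
    using f f' by (intro interchange) (auto intro!: Comp_in)
  show ?thesis
    using 1 2 by (simp add: push_add pull_add mult_add)
qed

lemma loop_Id: "loop k k (Id M (diag k)) = Id M (Zero M)"
  by simp

text \<open>
  An arrow \<open>f : p \<rightarrow> q\<close> is moved to an endomorphism of \<open>0\<close> by adding an object \<open>w\<close> that turns both
  ends into multiples of \<open>x + y\<close>.
\<close>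

definition shift :: "nat \<times> nat \<Rightarrow> nat \<times> nat \<Rightarrow> nat \<times> nat \<Rightarrow> 'm \<Rightarrow> 'm" where
  "shift w p q f = loop (fst p + fst w) (fst q + fst w)
     (Addh M (val p) (val w) (val q) (val w) f (Id M (val w)))"

abbreviation balances :: "nat \<times> nat \<Rightarrow> nat \<times> nat \<Rightarrow> bool" where
  "balances w p \<equiv> fst p + fst w = snd p + snd w"

lemma val_balances: "balances w p \<Longrightarrow> Add M (val p) (val w) = diag (fst p + fst w)"
  using val_padd[of p w] val_diag[of "fst p + fst w"] by simp

lemma shift_body_in:
  assumes "balances w p" "balances w q" "f \<in> Hom M (val p) (val q)"
  shows "Addh M (val p) (val w) (val q) (val w) f (Id M (val w))
      \<in> Hom M (diag (fst p + fst w)) (diag (fst q + fst w))"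
  using Addh_in[of "val p" "val w" "val q" "val w" f "Id M (val w)"] assms
  by (simp add: val_balances del: val.simps)

lemma shift_in:
  "\<lbrakk>balances w p; balances w q; f \<in> Hom M (val p) (val q)\<rbrakk> \<Longrightarrow> shift w p q f \<in> Hom M (Zero M) (Zero M)"
  unfolding shift_def by (intro loop_in shift_body_in)

text \<open>With one \<open>w\<close> for all three objects the ends match. Interchange gives
  \<open>(f + 1)(g + 1) = fg + 1\<close>, and then the loops compose.\<close>

lemma shift_Comp:
  assumes "balances w p" "balances w q" "balances w r"
    and f: "f \<in> Hom M (val p) (val q)" and g: "g \<in> Hom M (val q) (val r)"
  shows "shift w p r (Comp M (val p) (val q) (val r) f g) =
    Comp M (Zero M) (Zero M) (Zero M) (shift w p q f) (shift w q r g)"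
proof -
  have "Addh M (val p) (val w) (val r) (val w) (Comp M (val p) (val q) (val r) f g) (Id M (val w)) =
     Comp M (diag (fst p + fst w)) (diag (fst q + fst w)) (diag (fst r + fst w))
       (Addh M (val p) (val w) (val q) (val w) f (Id M (val w)))
       (Addh M (val q) (val w) (val r) (val w) g (Id M (val w)))"
    using interchange[of "val p" "val q" "val r" "val w" "val w" "val w"
        f g "Id M (val w)" "Id M (val w)"] assms
    by (simp add: val_balances del: val.simps)
  then show ?thesis
    unfolding shift_def
    using loop_Comp[OF shift_body_in[OF assms(1,2) f] shift_body_in[OF assms(2,3) g]] by simp
qed

text \<open>\<open>Addh_middle\<close> turns \<open>(f + f') + 1\<close> into
  \<open>(f + 1) + (f' + 1)\<close>, \<open>loop_Addh\<close> splits the loop, and Eckmann-Hilton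
  replaces the sum in \<open>End(0)\<close> by composition.\<close>

lemma shift_Addh:
  assumes "balances w p" "balances w q" "balances w' p'" "balances w' q'"
    and f: "f \<in> Hom M (val p) (val q)" and f': "f' \<in> Hom M (val p') (val q')"
  shows "shift (padd w w') (padd p p') (padd q q') (Addh M (val p) (val p') (val q) (val q') f f') =
    Comp M (Zero M) (Zero M) (Zero M) (shift w p q f) (shift w' p' q' f')"
proof -
  have "Addh M (val (padd p p')) (val (padd w w')) (val (padd q q')) (val (padd w w'))
       (Addh M (val p) (val p') (val q) (val q') f f') (Id M (val (padd w w'))) =
     Addh M (diag (fst p + fst w)) (diag (fst p' + fst w'))
       (diag (fst q + fst w)) (diag (fst q' + fst w'))
       (Addh M (val p) (val w) (val q) (val w) f (Id M (val w)))
       (Addh M (val p') (val w') (val q') (val w') f' (Id M (val w')))"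
    using Addh_middle[of "val p" "val p'" "val w" "val w'" "val q" "val q'" "val w" "val w'"
        f f' "Id M (val w)" "Id M (val w')"] assms
    unfolding val_padd
    by (simp add: val_balances Addh_Id del: val.simps)
  then have "shift (padd w w') (padd p p') (padd q q') (Addh M (val p) (val p') (val q) (val q') f f') =
    Addh M (Zero M) (Zero M) (Zero M) (Zero M) (shift w p q f) (shift w' p' q' f')"
    unfolding shift_def
    using loop_Addh[OF shift_body_in[OF assms(1,2) f] shift_body_in[OF assms(3,4) f']]
    by (simp add: ac_simps del: val.simps)
  then show ?thesis
    using assms by (simp add: Addh_Zero_Zero shift_in)
qed

lemma shift_Id: "balances w p \<Longrightarrow> shift w p p (Id M (val p)) = Id M (Zero M)"
  unfolding shift_def by (simp add: Addh_Id val_balances loop_Id del: val.simps)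

text \<open>Enlarging \<open>w\<close> by a diagonal pair changes nothing, and any two balancing
  pairs become equal after such enlargements.\<close>

lemma shift_independent:
  assumes b: "balances w p" "balances w q" "balances w' p" "balances w' q"
    and f: "f \<in> Hom M (val p) (val q)"
  shows "shift w p q f = shift w' p q f"
proof -
  \<comment> \<open>Write \<open>f\<close> as \<open>f + 1\<close> with the identity of
    \<open>0\<close>; by \<open>shift_Addh\<close> the extra \<open>(k, k)\<close> contributes only
    the shift of that identity.\<close>
  have stab: "shift (padd w (k, k)) p q f = shift w p q f" if "balances w p" "balances w q" for w k
  proof -
    have "shift (padd w (k, k)) (padd p (0, 0)) (padd q (0, 0))
        (Addh M (val p) (val (0, 0)) (val q) (val (0, 0)) f (Id M (val (0, 0)))) =
      Comp M (Zero M) (Zero M) (Zero M) (shift w p q f) (shift (k, k) (0, 0) (0, 0) (Id M (val (0, 0))))"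
      using that f by (intro shift_Addh) auto
    moreover have "shift (k, k) (0, 0) (0, 0) (Id M (val (0, 0))) = Id M (Zero M)"
      by (rule shift_Id) simp
    ultimately show ?thesis
      using that f by (simp add: shift_in del: val.simps)
  qed
  \<comment> \<open>Both pairs balance \<open>p\<close>, so their components have the same
    difference.\<close>
  have "padd w (fst w', fst w') = padd w' (fst w, fst w)"
    using b by auto
  then show ?thesis
    using stab[OF b(1,2)] stab[OF b(3,4)] by metis
qed

text \<open>For \<open>p = (m, n)\<close> the swapped pair \<open>(n, m)\<close> always balances
  \<open>p\<close>; by \<open>shift_independent\<close> any other pair balancing both ends gives the
  same result.\<close>

definition collapse :: "nat \<times> nat \<Rightarrow> nat \<times> nat \<Rightarrow> 'm \<Rightarrow> 'm" where
  "collapse p q f = shift (prod.swap p) p q f"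

text \<open>Nothing is added, and \<open>push 0\<close> and \<open>pull 0\<close> are identities.
  This makes \<open>h\<close> an isomorphism on the third homotopy group.\<close>

lemma collapse_zero: "f \<in> Hom M (Zero M) (Zero M) \<Longrightarrow> collapse (0, 0) (0, 0) f = f"
  by (simp add: collapse_def shift_def)

lemma collapse_Id: "collapse p p (Id M (val p)) = Id M (Zero M)"
  unfolding collapse_def by (intro shift_Id) simp

end

text \<open>In the application \<open>m - n\<close> is the degree of \<open>val (m, n)\<close> in
  the integers. Arrows preserve it, so one \<open>w\<close> can balance both ends; the equation is
  written additively because the entries are natural numbers.\<close>

locale generating_pair = weak_inverse_pair M x y \<phi> \<psi>
  for M :: "('o, 'm) moncat" and x y \<phi> \<psi> +
  assumes same_degree: "f \<in> Hom M (val p) (val q) \<Longrightarrow> fst p + snd q = snd p + fst q"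
begin

lemma balances_swap: "f \<in> Hom M (val p) (val q) \<Longrightarrow> balances (prod.swap p) q"
  using same_degree[of f p q] by simp

lemma collapse_in: "f \<in> Hom M (val p) (val q) \<Longrightarrow> collapse p q f \<in> Hom M (Zero M) (Zero M)"
  unfolding collapse_def using balances_swap by (intro shift_in) auto

text \<open>The composite is shifted by the swap of \<open>p\<close>, but \<open>g\<close> alone by
  the swap of \<open>q\<close>; \<open>shift_independent\<close> reconciles them.\<close>

lemma collapse_Comp:
  assumes f: "f \<in> Hom M (val p) (val q)" and g: "g \<in> Hom M (val q) (val r)"
  shows "collapse p r (Comp M (val p) (val q) (val r) f g) =
    Comp M (Zero M) (Zero M) (Zero M) (collapse p q f) (collapse q r g)"
proof -
  have r: "balances (prod.swap p) r"
    using f g by (intro balances_swap[of "Comp M (val p) (val q) (val r) f g"] Comp_in) auto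
  have "shift (prod.swap p) q r g = shift (prod.swap q) q r g"
    using balances_swap[OF f] balances_swap[OF g] r g by (intro shift_independent) auto
  then show ?thesis
    unfolding collapse_def
    using shift_Comp[OF _ balances_swap[OF f] r f g] by simp
qed

text \<open>Swapping is additive, so the balancing pair of a sum is the sum of the balancing
  pairs.\<close>

lemma collapse_Addh:
  assumes f: "f \<in> Hom M (val p) (val q)" and f': "f' \<in> Hom M (val p') (val q')"
  shows "collapse (padd p p') (padd q q') (Addh M (val p) (val p') (val q) (val q') f f') =
    Addh M (Zero M) (Zero M) (Zero M) (Zero M) (collapse p q f) (collapse p' q' f')"
  unfolding Addh_Zero_Zero[OF collapse_in[OF f] collapse_in[OF f']]
  unfolding collapse_def
  using shift_Addh[OF _ balances_swap[OF f] _ balances_swap[OF f'] f f'] by simp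

text \<open>The pairs \<open>(m, n)\<close> are coded by \<open>j\<close>, as all cells of an \<open>ncat\<close> are of one type.\<close>

definition words :: "(nat \<times> nat \<Rightarrow> 'u) \<Rightarrow> ('u, 'm) moncat" where
  "words j = (let V = (\<lambda>u. val (inv_into UNIV j u)) in
     \<lparr>Obj = range j,
      Hom = (\<lambda>u v. Hom M (V u) (V v)),
      Comp = (\<lambda>u v w. Comp M (V u) (V v) (V w)),
      Id = (\<lambda>u. Id M (V u)),
      Add = (\<lambda>u v. j (padd (inv_into UNIV j u) (inv_into UNIV j v))),
      Zero = j (0, 0),
      Addh = (\<lambda>u u' v v'. Addh M (V u) (V u') (V v) (V v'))\<rparr>)"

text \<open>Objects add as pairs and arrows add in \<open>M\<close>. By \<open>val_plus\<close> the
  ends agree strictly, so the laws for arrows are inherited.\<close>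

lemma comm_moncat_words:
  assumes j: "inj j"
  shows "comm_moncat (words j)"
proof -
  show ?thesis
    by unfold_locales
      (auto simp: words_def val_plus inv_f_f[OF j] ac_simps Comp_assoc Addh_assoc Addh_Id interchange
        simp del: val.simps intro: Addh_comm)
qed

lemma isom_rel_words:
  assumes j: "inj j"
  shows "(j p, j q) \<in> isom_rel (words j) \<longleftrightarrow> (val p, val q) \<in> isom_rel M"
  by (simp add: isom_rel_def inverse_homs_def words_def inv_f_f[OF j] del: val.simps)

end

text \<open>All laws are instances at \<open>0\<close>; those with ends \<open>0 + 0\<close> are
  first restated with these ends reduced.\<close>

lemma (in comm_moncat) comm_moncat_End_Zero: "comm_moncat (M\<lparr>Obj := {Zero M}\<rparr>)"
proof -
  have "Addh M (Zero M) (Zero M) (Zero M) (Zero M) (Addh M (Zero M) (Zero M) (Zero M) (Zero M) f g) h =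
      Addh M (Zero M) (Zero M) (Zero M) (Zero M) f (Addh M (Zero M) (Zero M) (Zero M) (Zero M) g h)"
    if "f \<in> Hom M (Zero M) (Zero M)" "g \<in> Hom M (Zero M) (Zero M)"
      "h \<in> Hom M (Zero M) (Zero M)" for f g h
    using Addh_assoc[of "Zero M" "Zero M" "Zero M" "Zero M" "Zero M" "Zero M" f g h] that by simp
  moreover have "Addh M (Zero M) (Zero M) (Zero M) (Zero M) f g \<in> Hom M (Zero M) (Zero M)"
    if "f \<in> Hom M (Zero M) (Zero M)" "g \<in> Hom M (Zero M) (Zero M)" for f g
    using Addh_in[of "Zero M" "Zero M" "Zero M" "Zero M" f g] that by simp
  moreover have "Comp M (Zero M) (Zero M) (Zero M)
      (Addh M (Zero M) (Zero M) (Zero M) (Zero M) f f')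
      (Addh M (Zero M) (Zero M) (Zero M) (Zero M) g g') =
      Addh M (Zero M) (Zero M) (Zero M) (Zero M)
      (Comp M (Zero M) (Zero M) (Zero M) f g) (Comp M (Zero M) (Zero M) (Zero M) f' g')"
    if "f \<in> Hom M (Zero M) (Zero M)" "f' \<in> Hom M (Zero M) (Zero M)"
      "g \<in> Hom M (Zero M) (Zero M)" "g' \<in> Hom M (Zero M) (Zero M)" for f f' g g'
    using interchange[of "Zero M" "Zero M" "Zero M" "Zero M" "Zero M" "Zero M" f g f' g'] that by simp
  ultimately show ?thesis
    by unfold_locales (auto simp: Comp_assoc intro: Addh_comm)
qed

section \<open>Double delooping\<close>

definition hom_ncat :: "('u, 'u) moncat \<Rightarrow> 'u ncat" where
  "hom_ncat M = EnrCat (Obj M) (\<lambda>u v. SetCat (Hom M u v))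
     (\<lambda>u v w. MapFun (\<lambda>(f, g). Comp M u v w f g)) (Id M)"

definition add_nfun :: "('u, 'u) moncat \<Rightarrow> ('u \<times> 'u, 'u) nfun" where
  "add_nfun M = EnrFun (\<lambda>(u, u'). Add M u u')
     (\<lambda>(u, u') (v, v'). MapFun (\<lambda>(f, f'). Addh M u u' v v' f f'))"

definition deloop1 :: "'u \<Rightarrow> ('u, 'u) moncat \<Rightarrow> 'u ncat" where
  "deloop1 s M = EnrCat {s} (\<lambda>_ _. hom_ncat M) (\<lambda>_ _ _. add_nfun M) (\<lambda>_. Zero M)"

text \<open>The element \<open>s\<close> serves both as the only object and as the only 1-arrow.\<close>

definition deloop2 :: "'u \<Rightarrow> ('u, 'u) moncat \<Rightarrow> 'u ncat" where
  "deloop2 s M = EnrCat {s} (\<lambda>_ _. deloop1 s M) (\<lambda>_ _ _. EnrFun (\<lambda>_. s) (\<lambda>_ _. add_nfun M)) (\<lambda>_. s)"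

lemma quotient_Id_on: "A // Id_on A = (\<lambda>x. {x}) ` A"
  by (auto simp: quotient_def)

lemma Id_on_Image_singleton: "x \<in> A \<Longrightarrow> Id_on A `` {x} = {x}"
  by auto

text \<open>Stated for any \<open>G\<close> with the data of \<open>M\<close>, to serve both
  \<open>hom_ncat M\<close> and \<open>endo C c\<close>. Arrows of the truncation are singletons, so
  inverses there are inverses in \<open>M\<close>.\<close>

lemma pi0_rel_eq_isom_rel:
  assumes "Obj M = ob G" "\<And>u v. Hom M u v = ob (hom_cat G u v)"
    "\<And>u v w f g. Comp M u v w f g = fob (cmp G u v w) (f, g)" "Id M = idn G"
    and closed: "\<And>u v f g. \<lbrakk>u \<in> Obj M; v \<in> Obj M; f \<in> Hom M u v; g \<in> Hom M v u\<rbrakk>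
        \<Longrightarrow> Comp M u v u f g \<in> Hom M u u"
    "\<And>u. u \<in> Obj M \<Longrightarrow> Id M u \<in> Hom M u u"
  shows "pi0_rel 1 G = isom_rel M"
    and "groupoid (tau1 1 G) \<Longrightarrow> u \<in> Obj M \<Longrightarrow> v \<in> Obj M \<Longrightarrow> f \<in> Hom M u v \<Longrightarrow> \<exists>g. inverse_homs M u v f g"
proof -
  have inv: "inverse_arrows (Defs.truncate (pi0_rel 0) G) u v {f} {g} \<longleftrightarrow> inverse_homs M u v f g"
    if "u \<in> Obj M" "v \<in> Obj M" for u v f g
  proof -
    \<comment> \<open>Outside the hom set the class of a composite would be empty; closure under
      composition excludes this.\<close>
    have "Id_on (ob (hom_cat G u u)) `` {fob (cmp G u v u) (f, g)} = {fob (cmp G u v u) (f, g)}"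
      if "f \<in> Hom M u v" "g \<in> Hom M v u" "u \<in> Obj M" "v \<in> Obj M" for u v f g
      using closed(1)[of u v f g] that assms(1-4) by (intro Id_on_Image_singleton) auto
    with that show ?thesis
      using closed(2)[of u] closed(2)[of v] that
      by (auto simp: inverse_arrows_def Defs.truncate_def inverse_homs_def quotient_Id_on image_iff
          assms(1-4) Id_on_Image_singleton)
  qed
  have inv': "inverse_arrows (Defs.truncate (pi0_rel 0) G) u v X Y \<longleftrightarrow>
      (\<exists>f g. X = {f} \<and> Y = {g} \<and> inverse_homs M u v f g)"
    if "u \<in> Obj M" "v \<in> Obj M" for u v X Y
  proof
    assume *: "inverse_arrows (Defs.truncate (pi0_rel 0) G) u v X Y"
    then obtain f g where "X = {f}" "Y = {g}"
      by (auto simp: inverse_arrows_def Defs.truncate_def quotient_Id_on)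
    with * inv[OF that] show "\<exists>f g. X = {f} \<and> Y = {g} \<and> inverse_homs M u v f g"
      by blast
  qed (use inv[OF that] in auto)
  show "pi0_rel 1 G = isom_rel M"
  proof -
    let ?K = "Defs.truncate (pi0_rel 0) G"
    have "(\<exists>X Y. inverse_arrows ?K u v X Y) \<longleftrightarrow> (\<exists>f g. inverse_homs M u v f g)"
      if "u \<in> Obj M" "v \<in> Obj M" for u v
      unfolding inv'[OF that] by auto
    moreover have "ob1 ?K = Obj M"
      by (simp add: Defs.truncate_def assms(1))
    ultimately have "(u, v) \<in> iso_rel ?K \<longleftrightarrow> (u, v) \<in> isom_rel M" for u v
      unfolding iso_rel_def isom_rel_def mem_Collect_eq prod.case by metis
    then show ?thesis
      unfolding One_nat_def pi0_rel.simps(2) by auto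
  qed
  assume grpd: "groupoid (tau1 1 G)" and uv: "u \<in> Obj M" "v \<in> Obj M" and f: "f \<in> Hom M u v"
  have "{f} \<in> hom1 (Defs.truncate (pi0_rel 0) G) u v" "ob1 (Defs.truncate (pi0_rel 0) G) = Obj M"
    using f by (simp_all add: Defs.truncate_def quotient_Id_on assms(1-4))
  moreover have "tau1 1 G = Defs.truncate (pi0_rel 0) G"
    by (simp add: tau1_def)
  ultimately obtain Y where "inverse_arrows (Defs.truncate (pi0_rel 0) G) u v {f} Y"
    using grpd uv unfolding groupoid_def by metis
  then show "\<exists>g. inverse_homs M u v f g"
    unfolding inv'[OF uv] by auto
qed

text \<open>In \<open>deloop2\<close> two compositions are given by the same sum. Functoriality of
  the outer one is \<open>Add_middle\<close> and \<open>Addh_middle\<close>, which rest on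
  commutativity.\<close>

lemma strict_cat_deloop:
  assumes "comm_moncat M"
  shows "strict_cat 1 (hom_ncat M)" "strict_cat 2 (deloop1 s M)" "strict_cat 3 (deloop2 s M)"
proof -
  interpret comm_moncat M by fact
  show "strict_cat 1 (hom_ncat M)"
    by (auto simp: hom_ncat_def Comp_assoc)
  show "strict_cat 2 (deloop1 s M)"
    by (auto simp: numeral_2_eq_2 deloop1_def add_nfun_def hom_ncat_def Comp_assoc Add_assoc Addh_Id
        Addh_assoc interchange)
  show "strict_cat 3 (deloop2 s M)"
    by (auto simp: numeral_3_eq_3 deloop2_def deloop1_def add_nfun_def hom_ncat_def Comp_assoc
        Addh_Id interchange
        intro: Add_assoc Addh_assoc Add_middle Addh_middle)
qed

text \<open>Objects have inverses only up to isomorphism, in keeping with groupoids without strict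
  inverses.\<close>

locale picard = comm_moncat M for M :: "('o, 'm) moncat" +
  assumes invertible: "\<lbrakk>u \<in> Obj M; v \<in> Obj M; f \<in> Hom M u v\<rbrakk> \<Longrightarrow> \<exists>g. inverse_homs M u v f g"
    and weakly_invertible: "u \<in> Obj M \<Longrightarrow> \<exists>w\<in>Obj M. (Add M u w, Zero M) \<in> isom_rel M"

definition pi2 :: "('o, 'm) moncat \<Rightarrow> 'o set monoid" where
  "pi2 M = \<lparr>carrier = Obj M // isom_rel M,
     monoid.mult = (\<lambda>X Y. \<Union>u\<in>X. \<Union>v\<in>Y. isom_rel M `` {Add M u v}),
     one = isom_rel M `` {Zero M}\<rparr>"

text \<open>Singletons and \<open>Id_on\<close> reproduce the form to which
  \<open>homotopy_group\<close> unfolds, so that the comparison below is an equality of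
  groups.\<close>

definition pi3 :: "('o, 'm) moncat \<Rightarrow> 'm set monoid" where
  "pi3 M = \<lparr>carrier = (\<lambda>f. {f}) ` Hom M (Zero M) (Zero M),
     monoid.mult = (\<lambda>X Y. \<Union>f\<in>X. \<Union>g\<in>Y.
       Id_on (Hom M (Zero M) (Zero M)) `` {Comp M (Zero M) (Zero M) (Zero M) f g}),
     one = Id_on (Hom M (Zero M) (Zero M)) `` {Id M (Zero M)}\<rparr>"

lemma groupoid_tau1_hom_ncat:
  assumes "picard M"
  shows "groupoid (tau1 1 (hom_ncat M))"
proof -
  interpret picard M by fact
  have sing: "A \<inter> {x} = {x}" if "x \<in> A" for A :: "'a set" and x
    using that by auto
  have K: "tau1 1 (hom_ncat M) = \<lparr>ob1 = Obj M, hom1 = (\<lambda>u v. (\<lambda>f. {f}) ` Hom M u v),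
      cmp1 = (\<lambda>u v w X Y. \<Union>f\<in>X. \<Union>g\<in>Y. Hom M u w \<inter> {Comp M u v w f g}),
      idn1 = (\<lambda>u. Hom M u u \<inter> {Id M u})\<rparr>"
    by (simp add: tau1_def Defs.truncate_def hom_ncat_def quotient_Id_on)
  have inv: "\<exists>g. inverse_arrows (tau1 1 (hom_ncat M)) u v {f} g"
    if uv: "u \<in> Obj M" "v \<in> Obj M" and f: "f \<in> Hom M u v" for u v f
  proof -
    obtain g where "inverse_homs M u v f g"
      using invertible[OF uv f] by blast
    then have "inverse_arrows (tau1 1 (hom_ncat M)) u v {f} {g}"
      using uv by (simp add: inverse_arrows_def inverse_homs_def K[unfolded One_nat_def] sing)
    then show ?thesis ..
  qed
  show ?thesis
    unfolding groupoid_def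
  proof (intro conjI ballI)
    show "category (tau1 1 (hom_ncat M))"
      unfolding category_def K by (simp add: sing Comp_assoc)
    fix u v X
    assume "u \<in> ob1 (tau1 1 (hom_ncat M))" "v \<in> ob1 (tau1 1 (hom_ncat M))"
      "X \<in> hom1 (tau1 1 (hom_ncat M)) u v"
    then obtain f where "X = {f}" and "u \<in> Obj M" "v \<in> Obj M" "f \<in> Hom M u v"
      by (auto simp: K[unfolded One_nat_def])
    with inv[of u v f] show "\<exists>Y. inverse_arrows (tau1 1 (hom_ncat M)) u v X Y"
      by simp
  qed
qed

lemma pi0_rel_hom_ncat:
  assumes "comm_moncat M"
  shows "pi0_rel (Suc 0) (hom_ncat M) = isom_rel M"
proof -
  interpret comm_moncat M by fact
  show ?thesis
    by (rule pi0_rel_eq_isom_rel(1)[unfolded One_nat_def]) (auto simp: hom_ncat_def)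
qed

text \<open>The arrows are the isomorphism classes of objects of \<open>M\<close>; a weak inverse
  \<open>w\<close> of \<open>u\<close> gives the inverse class, on the other side by
  commutativity.\<close>

lemma groupoid_tau1_deloop1:
  assumes "picard M"
  shows "groupoid (tau1 2 (deloop1 s M))"
proof -
  interpret picard M by fact
  let ?R = "isom_rel M"
  have K: "tau1 2 (deloop1 s M) = \<lparr>ob1 = {s}, hom1 = (\<lambda>_ _. Obj M // ?R),
      cmp1 = (\<lambda>_ _ _ X Y. \<Union>u\<in>X. \<Union>v\<in>Y. ?R `` {Add M u v}), idn1 = (\<lambda>_. ?R `` {Zero M})\<rparr>"
    using pi0_rel_hom_ncat[OF comm_moncat_axioms]
    by (simp add: tau1_def Defs.truncate_def deloop1_def add_nfun_def) (simp add: hom_ncat_def)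
  have inv: "\<exists>Y. inverse_arrows (tau1 2 (deloop1 s M)) s s (?R `` {u}) Y" if u: "u \<in> Obj M" for u
  proof -
    obtain w where w: "w \<in> Obj M" "(Add M u w, Zero M) \<in> ?R"
      using weakly_invertible[OF u] by blast
    moreover have "?R `` {Add M u w} = ?R `` {Zero M}"
      using w equiv_class_eq[OF equiv_isom_rel] by blast
    ultimately have "inverse_arrows (tau1 2 (deloop1 s M)) s s (?R `` {u}) (?R `` {w})"
      using u Add_comm[of w u] by (simp add: inverse_arrows_def K UN_class_Add quotientI)
    then show ?thesis ..
  qed
  have ball: "(\<forall>X\<in>Obj M // ?R. P X) \<longleftrightarrow> (\<forall>u\<in>Obj M. P (?R `` {u}))" for P
    by (auto simp: quotient_def)
  have "category (tau1 2 (deloop1 s M))"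
    unfolding category_def K by (simp add: ball UN_class_Add Add_assoc quotientI del: UN_simps)
  moreover have "\<exists>Y. inverse_arrows (tau1 2 (deloop1 s M)) s s X Y" if "X \<in> Obj M // ?R" for X
    using that by (auto elim!: quotientE simp: inv)
  moreover have "ob1 (tau1 2 (deloop1 s M)) = {s}" "hom1 (tau1 2 (deloop1 s M)) s s = Obj M // ?R"
    by (simp_all add: K)
  ultimately show ?thesis
    unfolding groupoid_def by simp
qed

lemma pi0_rel_one_object:
  assumes "strict_groupoid n A" "ob A = {s}"
  shows "pi0_rel n A = {(s, s)}"
  using equiv_pi0_rel[OF assms(1)] assms(2) unfolding equiv_def refl_on_def by auto

lemma strict_groupoid_deloop:
  assumes "picard M"
  shows "strict_groupoid 1 (hom_ncat M)" "strict_groupoid 2 (deloop1 s M)"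
    "strict_groupoid 3 (deloop2 s M)"
proof -
  interpret picard M by fact
  note cat = strict_cat_deloop[OF comm_moncat_axioms]
  show 1: "strict_groupoid 1 (hom_ncat M)"
    using cat(1) groupoid_tau1_hom_ncat[OF assms]
    by (simp del: strict_cat.simps(2)) (simp add: hom_ncat_def)
  show 2: "strict_groupoid 2 (deloop1 s M)"
    using cat(2) 1 groupoid_tau1_deloop1[OF assms]
    by (simp add: numeral_2_eq_2 del: strict_cat.simps(2) strict_groupoid.simps(2)
        add: strict_groupoid.simps(2)[of "Suc 0"]) (simp add: deloop1_def)
  have R: "pi0_rel 2 (deloop1 s M) = {(s, s)}"
    by (rule pi0_rel_one_object[OF 2]) (simp add: deloop1_def)
  have im: "{(s, s)} `` {s} = {s}"
    by auto
  \<comment> \<open>As \<open>deloop1\<close> has a single object, this truncation has one object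
    and one arrow.\<close>
  have K: "tau1 3 (deloop2 s M) = \<lparr>ob1 = {s}, hom1 = (\<lambda>_ _. {{(s, s)} `` {s}}),
      cmp1 = (\<lambda>_ _ _ X Y. \<Union>u\<in>X. \<Union>v\<in>Y. {(s, s)} `` {s}), idn1 = (\<lambda>_. {(s, s)} `` {s})\<rparr>"
    using R by (simp add: tau1_def Defs.truncate_def deloop2_def) (simp add: deloop1_def quotient_def)
  have "groupoid (tau1 3 (deloop2 s M))"
    by (simp add: groupoid_def category_def inverse_arrows_def K im)
  then show "strict_groupoid 3 (deloop2 s M)"
    using cat(3) 2
    by (simp add: numeral_3_eq_3 numeral_2_eq_2 del: strict_cat.simps(2) strict_groupoid.simps(2)
        add: strict_groupoid.simps(2)[of "Suc (Suc 0)"]) (simp add: deloop2_def)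
qed

lemma homotopy_deloop:
  assumes "picard M"
  shows "pi0 3 (deloop2 s M) = {{s}}"
    and "pi0 2 (deloop1 s M) = {{s}}"
    and "trivial_group (homotopy_group 3 1 (deloop2 s M) s)"
proof -
  interpret picard M by fact
  note grpd = strict_groupoid_deloop[OF assms]
  show "pi0 3 (deloop2 s M) = {{s}}"
    using pi0_rel_one_object[OF grpd(3), of s s] by (auto simp: pi0_def deloop2_def quotient_def)
  show pi0: "pi0 2 (deloop1 s M) = {{s}}"
    using pi0_rel_one_object[OF grpd(2), of s s] by (auto simp: pi0_def deloop1_def quotient_def)
  have grp: "group (homotopy_group 3 1 (deloop2 s M) s)"
    by (rule homotopy_group_group[OF grpd(3)]) (auto simp: deloop2_def)
  moreover have "carrier (homotopy_group 3 1 (deloop2 s M) s) = {{s}}"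
    using pi0 by (simp add: deloop2_def)
  ultimately show "trivial_group (homotopy_group 3 1 (deloop2 s M) s)"
    unfolding trivial_group_def using group.is_monoid[OF grp, THEN monoid.one_closed] by simp
qed

section \<open>The endomorphisms of an identity 1-arrow\<close>

text \<open>Of the two multiplications, the sum is the composition of 2-cells along the 1-cell
  \<open>1_c\<close>; \<open>endo_cmp\<close> identifies it with the one along the object
  \<open>c\<close>.\<close>

definition endo :: "'u ncat \<Rightarrow> 'u \<Rightarrow> ('u, 'u) moncat" where
  "endo C c = (let A = hom_cat C c c; i = idn C c; G = hom_cat A i i; Q = cmp A i i i in
     \<lparr>Obj = ob G,
      Hom = (\<lambda>u v. ob (hom_cat G u v)),
      Comp = (\<lambda>u v w f g. fob (cmp G u v w) (f, g)),
      Id = idn G,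
      Add = (\<lambda>u v. fob Q (u, v)),
      Zero = idn A i,
      Addh = (\<lambda>u u' v v' f g. fob (fhom Q (u, u') (v, v')) (f, g))\<rparr>)"

text \<open>Composition in \<open>C\<close> is a functor on \<open>A \<times> A\<close>, which gives
  the interchange law between the two multiplications; the unit laws of \<open>A\<close> and
  \<open>C\<close> give them the same unit \<open>z\<close>. Eckmann-Hilton does the rest.\<close>

lemma
  assumes C: "strict_cat 3 C" and c: "c \<in> ob C"
  shows comm_moncat_endo: "comm_moncat (endo C c)"
    and endo_cmp: "fob (cmp C c c c) (idn C c, idn C c) = idn C c"
      "\<lbrakk>u \<in> Obj (endo C c); v \<in> Obj (endo C c)\<rbrakk>
        \<Longrightarrow> fob (fhom (cmp C c c c) (idn C c, idn C c) (idn C c, idn C c)) (u, v) = Add (endo C c) u v"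
      "\<lbrakk>u \<in> Obj (endo C c); v \<in> Obj (endo C c); u' \<in> Obj (endo C c); v' \<in> Obj (endo C c);
         f \<in> Hom (endo C c) u u'; g \<in> Hom (endo C c) v v'\<rbrakk>
        \<Longrightarrow> fob (fhom (fhom (cmp C c c c) (idn C c, idn C c) (idn C c, idn C c)) (u, v) (u', v')) (f, g) =
            Addh (endo C c) u v u' v' f g"
proof -
  define A where "A = hom_cat C c c"
  define i where "i = idn C c"
  define G where "G = hom_cat A i i"
  define Q where "Q = cmp A i i i"
  define z where "z = idn A i"
  define P where "P = fhom (cmp C c c c) (i, i) (i, i)"
  note C = C[unfolded numeral_3_eq_3 strict_cat.simps(2)[of "Suc (Suc 0)"]]
  have A: "strict_cat (Suc (Suc 0)) A"
    using C c unfolding A_def by blast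
  have i: "i \<in> ob A"
    using C c unfolding A_def i_def by blast
  have K: "strict_functor (Suc (Suc 0)) (prod_cat (Suc (Suc 0)) A A) A (cmp C c c c)"
    using C c unfolding A_def by blast
  have KL: "fun_eq (Suc (Suc 0)) A (fun_comp (Suc (Suc 0)) (cmp C c c c)
      (fun_comp (Suc (Suc 0)) (fun_prod (Suc (Suc 0)) (const_fun (Suc (Suc 0)) A i)
          (fun_id (Suc (Suc 0))))
                (cellwise (Suc (Suc 0)) (\<lambda>f. (f, f))))) (fun_id (Suc (Suc 0)))"
   and KR: "fun_eq (Suc (Suc 0)) A (fun_comp (Suc (Suc 0)) (cmp C c c c)
      (fun_comp (Suc (Suc 0)) (fun_prod (Suc (Suc 0)) (fun_id (Suc (Suc 0)))
          (const_fun (Suc (Suc 0)) A i))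
                (cellwise (Suc (Suc 0)) (\<lambda>f. (f, f))))) (fun_id (Suc (Suc 0)))"
    using C c unfolding A_def i_def by blast+
  \<comment> \<open>The unit law of \<open>C\<close> at the object \<open>i\<close>; it makes
    \<open>P\<close> land in \<open>G\<close> itself.\<close>
  have Kii: "fob (cmp C c c c) (i, i) = i"
    using KL i by simp
  \<comment> \<open>The unit law of \<open>C\<close> on the hom category of \<open>A\<close> at
    \<open>(i, i)\<close>: there the constant morphism at \<open>i\<close> becomes the one at
    \<open>z\<close>.\<close>
  have PL: "fun_eq (Suc 0) G (fun_comp (Suc 0) P
      (fun_comp (Suc 0) (fun_prod (Suc 0) (const_fun (Suc 0) G z) (fun_id (Suc 0)))
                (cellwise (Suc 0) (\<lambda>f. (f, f))))) (fun_id (Suc 0))"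
    using KL i unfolding fun_eq.simps(2)[of "Suc 0"]
    by (simp add: G_def z_def P_def)
  have PR: "fun_eq (Suc 0) G (fun_comp (Suc 0) P
      (fun_comp (Suc 0) (fun_prod (Suc 0) (fun_id (Suc 0)) (const_fun (Suc 0) G z))
                (cellwise (Suc 0) (\<lambda>f. (f, f))))) (fun_id (Suc 0))"
    using KR i unfolding fun_eq.simps(2)[of "Suc 0"]
    by (simp add: G_def z_def P_def)
  \<comment> \<open>The condition on composition for the functor \<open>cmp C c c c\<close>, with
    all objects equal to \<open>(i, i)\<close>.\<close>
  have PQ: "fun_eq (Suc 0) (prod_cat (Suc 0) (prod_cat (Suc 0) G G) (prod_cat (Suc 0) G G))
      (fun_comp (Suc 0) P (fun_comp (Suc 0) (fun_prod (Suc 0) Q Q)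
            (cellwise (Suc 0) (\<lambda>((f, f'), (g, g')). ((f, g), (f', g'))))))
      (fun_comp (Suc 0) Q (fun_prod (Suc 0) P P))"
    using K i Kii unfolding strict_functor.simps(2)[of "Suc 0"] prod_cat.simps(2)[of "Suc 0"]
    unfolding G_def Q_def P_def A_def by fastforce
  note A = A[unfolded strict_cat.simps(2)[of "Suc 0"]]
  have G: "strict_cat (Suc 0) G"
    using A i unfolding G_def by blast
  have z: "z \<in> ob G"
    using A i unfolding G_def z_def by blast
  have Q: "strict_functor (Suc 0) (prod_cat (Suc 0) G G) G Q"
    using A i unfolding G_def Q_def by blast
  have QL: "fun_eq (Suc 0) G (fun_comp (Suc 0) Q
      (fun_comp (Suc 0) (fun_prod (Suc 0) (const_fun (Suc 0) G z) (fun_id (Suc 0)))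
                (cellwise (Suc 0) (\<lambda>f. (f, f))))) (fun_id (Suc 0))"
   and QR: "fun_eq (Suc 0) G (fun_comp (Suc 0) Q
      (fun_comp (Suc 0) (fun_prod (Suc 0) (fun_id (Suc 0)) (const_fun (Suc 0) G z))
                (cellwise (Suc 0) (\<lambda>f. (f, f))))) (fun_id (Suc 0))"
    using A i unfolding G_def Q_def z_def by blast+
  have QA: "fun_eq (Suc 0) (prod_cat (Suc 0) (prod_cat (Suc 0) G G) G)
       (fun_comp (Suc 0) Q (fun_prod (Suc 0) Q (fun_id (Suc 0))))
       (fun_comp (Suc 0) Q (fun_comp (Suc 0) (fun_prod (Suc 0) (fun_id (Suc 0)) Q)
                (cellwise (Suc 0) (\<lambda>((f, g), h). (f, (g, h))))))"
    using A i unfolding G_def Q_def by blast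

  \<comment> \<open>The laws are now read off elementwise: \<open>a\<close>, \<open>b\<close> are
    the two multiplications on 2-cells, and \<open>ah\<close>, \<open>bh\<close> those on
    3-cells.\<close>
  define H where "H = (\<lambda>u v. ob (hom_cat G u v))"
  define a where "a = (\<lambda>u v. fob Q (u, v))"
  define b where "b = (\<lambda>u v. fob P (u, v))"
  define ah where "ah = (\<lambda>u u' v v' f g. fob (fhom Q (u, u') (v, v')) (f, g))"
  define bh where "bh = (\<lambda>u u' v v' f g. fob (fhom P (u, u') (v, v')) (f, g))"
  define e where "e = idn G"
  have ez: "e z \<in> H z z" using G z by (simp add: H_def e_def)
  have aL: "a z u = u" if "u \<in> ob G" for u using QL that by (simp add: a_def)
  have aR: "a u z = u" if "u \<in> ob G" for u using QR that by (simp add: a_def)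
  have bL: "b z u = u" if "u \<in> ob G" for u using PL that by (simp add: b_def)
  have bR: "b u z = u" if "u \<in> ob G" for u using PR that by (simp add: b_def)
  have ahL: "ah z u z v (e z) f = f" if "u \<in> ob G" "v \<in> ob G" "f \<in> H u v" for u v f
    using QL that by (simp add: ah_def H_def e_def)
  have ahR: "ah u z v z f (e z) = f" if "u \<in> ob G" "v \<in> ob G" "f \<in> H u v" for u v f
    using QR that by (simp add: ah_def H_def e_def)
  have bhL: "bh z u z v (e z) f = f" if "u \<in> ob G" "v \<in> ob G" "f \<in> H u v" for u v f
    using PL that by (simp add: bh_def H_def e_def)
  have bhR: "bh u z v z f (e z) = f" if "u \<in> ob G" "v \<in> ob G" "f \<in> H u v" for u v f
    using PR that by (simp add: bh_def H_def e_def)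
  have ab: "b (a s t) (a u v) = a (b s u) (b t v)" if "s \<in> ob G" "t \<in> ob G" "u \<in> ob G" "v \<in> ob G"
      for s t u v
    using PQ that by (simp add: a_def b_def)
  have abh: "bh (a s t) (a u v) (a s' t') (a u' v') (ah s t s' t' f g) (ah u v u' v' h k)
     = ah (b s u) (b t v) (b s' u') (b t' v') (bh s u s' u' f h) (bh t v t' v' g k)"
    if "s \<in> ob G" "t \<in> ob G" "u \<in> ob G" "v \<in> ob G" "s' \<in> ob G" "t' \<in> ob G" "u' \<in> ob G" "v' \<in> ob G"
      "f \<in> H s s'" "g \<in> H t t'" "h \<in> H u u'" "k \<in> H v v'" for s t u v s' t' u' v' f g h k
    using PQ that by (simp add: a_def b_def ah_def bh_def H_def)
  \<comment> \<open>Eckmann--Hilton, for \<open>a\<close> from composition of 1-cells in \<open>A\<close> and \<open>b\<close> from that in \<open>C\<close>\<close>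
  have a_b: "b u v = a u v" if "u \<in> ob G" "v \<in> ob G" for u v
    using ab[of u z z v] that z by (simp add: aL aR bL bR)
  have a_comm: "a u v = a v u" if "u \<in> ob G" "v \<in> ob G" for u v
    using ab[of z v u z] that z by (simp add: aL aR bL bR a_b)
  have ah_bh: "bh u v u' v' f g = ah u v u' v' f g"
    if "u \<in> ob G" "v \<in> ob G" "u' \<in> ob G" "v' \<in> ob G" "f \<in> H u u'" "g \<in> H v v'" for u v u' v' f g
    using abh[of u z z v u' z z v' f "e z" "e z" g] that z ez by (simp add: aL aR bL bR ahL ahR bhL bhR)
  have ah_comm: "ah v u v' u' g f = ah u v u' v' f g"
    if "u \<in> ob G" "v \<in> ob G" "u' \<in> ob G" "v' \<in> ob G" "f \<in> H u u'" "g \<in> H v v'" for u v u' v' f g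
    using abh[of z v u z z v' u' z "e z" g f "e z"] that z ez
    by (simp add: aL aR bL bR ahL ahR bhL bhR ah_bh)
  have M: "endo C c = \<lparr>Obj = ob G, Hom = H, Comp = (\<lambda>u v w f g. fob (cmp G u v w) (f, g)), Id = e,
      Add = a, Zero = z, Addh = ah\<rparr>"
    by (simp add: endo_def Let_def A_def G_def H_def e_def a_def ah_def i_def Q_def z_def)
  have aC: "a u v \<in> ob G" if "u \<in> ob G" "v \<in> ob G" for u v
    using Q that by (simp add: a_def)
  have ahC: "ah u u' v v' f g \<in> H (a u u') (a v v')"
    if "u \<in> ob G" "u' \<in> ob G" "v \<in> ob G" "v' \<in> ob G" "f \<in> H u v" "g \<in> H u' v'" for u v u' v' f g
    using Q that by (simp add: a_def ah_def H_def)
  have aA: "a (a u v) w = a u (a v w)" if "u \<in> ob G" "v \<in> ob G" "w \<in> ob G" for u v w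
    using QA that by (simp add: a_def)
  have ahA: "ah (a u v) w (a u' v') w' (ah u v u' v' f g) h
      = ah u (a v w) u' (a v' w') f (ah v w v' w' g h)"
    if "u \<in> ob G" "v \<in> ob G" "w \<in> ob G" "u' \<in> ob G" "v' \<in> ob G" "w' \<in> ob G"
      "f \<in> H u u'" "g \<in> H v v'" "h \<in> H w w'" for u v w u' v' w' f g h
    using QA that by (simp add: a_def ah_def H_def)
  have ahI: "ah u v u v (e u) (e v) = e (a u v)" if "u \<in> ob G" "v \<in> ob G" for u v
    using Q that by (simp add: a_def ah_def e_def)
  have ahX: "fob (cmp G (a u u') (a v v') (a w w')) (ah u u' v v' f f', ah v v' w w' g g') =
      ah u u' w w' (fob (cmp G u v w) (f, g)) (fob (cmp G u' v' w') (f', g'))"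
    if "u \<in> ob G" "v \<in> ob G" "w \<in> ob G" "u' \<in> ob G" "v' \<in> ob G" "w' \<in> ob G"
      "f \<in> H u v" "g \<in> H v w" "f' \<in> H u' v'" "g' \<in> H v' w'" for u v w u' v' w' f g f' g'
    using Q that by (simp add: a_def ah_def H_def)
  have G1: "e u \<in> H u u" if "u \<in> ob G" for u
    using G that by (simp add: H_def e_def)
  have G2: "fob (cmp G u v w) (f, g) \<in> H u w"
    if "u \<in> ob G" "v \<in> ob G" "w \<in> ob G" "f \<in> H u v" "g \<in> H v w" for u v w f g
    using G that by (simp add: H_def)
  have G3: "fob (cmp G u u v) (e u, f) = f" "fob (cmp G u v v) (f, e v) = f"
    if "u \<in> ob G" "v \<in> ob G" "f \<in> H u v" for u v f
    using G that by (simp_all add: H_def e_def)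
  have G4: "fob (cmp G t v w) (fob (cmp G t u v) (f, g), h)
      = fob (cmp G t u w) (f, fob (cmp G u v w) (g, h))"
    if "t \<in> ob G" "u \<in> ob G" "v \<in> ob G" "w \<in> ob G" "f \<in> H t u" "g \<in> H u v" "h \<in> H v w" for t u v w f g h
    using G that by (simp add: H_def)
  show "comm_moncat (endo C c)"
    unfolding M using z by unfold_locales
    (auto simp: aC ahC aA ahA aL ahL ahI ahX G1 G2 G3 G4 intro: a_comm ah_comm)
  show "fob (cmp C c c c) (idn C c, idn C c) = idn C c"
    using Kii unfolding i_def .
  show "fob (fhom (cmp C c c c) (idn C c, idn C c) (idn C c, idn C c)) (u, v) = Add (endo C c) u v"
    if "u \<in> Obj (endo C c)" "v \<in> Obj (endo C c)"
    using a_b[of u v] that unfolding M by (simp add: b_def P_def i_def)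
  show "fob (fhom (fhom (cmp C c c c) (idn C c, idn C c) (idn C c, idn C c)) (u, v) (u', v')) (f, g) =
            Addh (endo C c) u v u' v' f g"
    if "u \<in> Obj (endo C c)" "v \<in> Obj (endo C c)" "u' \<in> Obj (endo C c)" "v' \<in> Obj (endo C c)"
         "f \<in> Hom (endo C c) u u'" "g \<in> Hom (endo C c) v v'"
    using ah_bh[of u v u' v' f g] that unfolding M by (simp add: bh_def P_def i_def)
qed

section \<open>Morphisms out of a double delooping\<close>

text \<open>A literal equality, so that facts about \<open>endo\<close> apply to deloopings by
  rewriting.\<close>

lemma endo_deloop2: "endo (deloop2 s M) s = M"
  by (simp add: endo_def deloop2_def deloop1_def hom_ncat_def add_nfun_def)

text \<open>\<open>s\<close> is the image of the object and \<open>t\<close> that of the 1-cell, in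
  use always the identity of \<open>s\<close>.\<close>

definition deloop_nfun :: "'u \<Rightarrow> 'u \<Rightarrow> ('u \<Rightarrow> 'u) \<Rightarrow> ('u \<Rightarrow> 'u \<Rightarrow> 'u \<Rightarrow> 'u) \<Rightarrow> ('u, 'u) nfun" where
  "deloop_nfun s t \<Phi> \<Psi> = EnrFun (\<lambda>_. s) (\<lambda>_ _. EnrFun (\<lambda>_. t) (\<lambda>_ _. EnrFun \<Phi> (\<lambda>u v. MapFun (\<Psi> u v))))"

locale monoidal_functor = M: comm_moncat M + N: comm_moncat N
  for M :: "('o, 'm) moncat" and N :: "('p, 'n) moncat" +
  fixes \<Phi> :: "'o \<Rightarrow> 'p" and \<Psi> :: "'o \<Rightarrow> 'o \<Rightarrow> 'm \<Rightarrow> 'n"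
  assumes obj: "u \<in> Obj M \<Longrightarrow> \<Phi> u \<in> Obj N"
    and hom: "\<lbrakk>u \<in> Obj M; v \<in> Obj M; f \<in> Hom M u v\<rbrakk> \<Longrightarrow> \<Psi> u v f \<in> Hom N (\<Phi> u) (\<Phi> v)"
    and Id: "u \<in> Obj M \<Longrightarrow> \<Psi> u u (Id M u) = Id N (\<Phi> u)"
    and Comp: "\<lbrakk>u \<in> Obj M; v \<in> Obj M; w \<in> Obj M; f \<in> Hom M u v; g \<in> Hom M v w\<rbrakk>
      \<Longrightarrow> \<Psi> u w (Comp M u v w f g) = Comp N (\<Phi> u) (\<Phi> v) (\<Phi> w) (\<Psi> u v f) (\<Psi> v w g)"
    and Zero: "\<Phi> (Zero M) = Zero N"
    and Add: "\<lbrakk>u \<in> Obj M; v \<in> Obj M\<rbrakk> \<Longrightarrow> \<Phi> (Add M u v) = Add N (\<Phi> u) (\<Phi> v)"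
    and Addh: "\<lbrakk>u \<in> Obj M; u' \<in> Obj M; v \<in> Obj M; v' \<in> Obj M; f \<in> Hom M u v; g \<in> Hom M u' v'\<rbrakk>
      \<Longrightarrow> \<Psi> (Add M u u') (Add M v v') (Addh M u u' v v' f g) =
          Addh N (\<Phi> u) (\<Phi> u') (\<Phi> v) (\<Phi> v') (\<Psi> u v f) (\<Psi> u' v' g)"

lemma strict_functor_deloop:
  assumes C: "strict_cat 3 C" "c \<in> ob C" and F: "monoidal_functor M (endo C c) \<Phi> \<Psi>"
  shows "strict_functor 3 (deloop2 s M) C (deloop_nfun c (idn C c) \<Phi> \<Psi>)"
proof -
  interpret monoidal_functor M "endo C c" \<Phi> \<Psi> by fact
  have i: "idn C c \<in> ob (hom_cat C c c)"
    using C by (simp add: numeral_3_eq_3)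
  note D = deloop2_def deloop1_def hom_ncat_def add_nfun_def deloop_nfun_def
  have 1: "strict_functor (Suc 0) (hom_ncat M) (hom_cat (hom_cat C c c) (idn C c) (idn C c))
      (EnrFun \<Phi> (\<lambda>u v. MapFun (\<Psi> u v)))"
    using obj hom Id Comp by (simp add: D endo_def Let_def)
  have 2: "strict_functor (Suc (Suc 0)) (deloop1 s M) (hom_cat C c c)
      (EnrFun (\<lambda>_. idn C c) (\<lambda>_ _. EnrFun \<Phi> (\<lambda>u v. MapFun (\<Psi> u v))))"
    unfolding strict_functor.simps(2)[of "Suc 0"]
    using i 1 Zero Add Addh by (simp add: deloop1_def) (simp add: D endo_def Let_def)
  \<comment> \<open>Composition along \<open>c\<close> is the second multiplication; by
    \<open>endo_cmp\<close> it is the same sum, so additivity again suffices.\<close>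
  have 3: "fun_eq (Suc (Suc 0)) (prod_cat (Suc (Suc 0)) (deloop1 s M) (deloop1 s M))
    (fun_comp (Suc (Suc 0)) (EnrFun (\<lambda>_. idn C c) (\<lambda>_ _. EnrFun \<Phi> (\<lambda>u v. MapFun (\<Psi> u v))))
      (cmp (deloop2 s M) s s s))
    (fun_comp (Suc (Suc 0)) (cmp C c c c)
      (fun_prod (Suc (Suc 0)) (EnrFun (\<lambda>_. idn C c) (\<lambda>_ _. EnrFun \<Phi> (\<lambda>u v. MapFun (\<Psi> u v))))
        (EnrFun (\<lambda>_. idn C c) (\<lambda>_ _. EnrFun \<Phi> (\<lambda>u v. MapFun (\<Psi> u v))))))"
    using obj hom by (simp add: D endo_cmp[OF C] Add Addh)
  show ?thesis
    unfolding numeral_3_eq_3 strict_functor.simps(2)[of "Suc (Suc 0)"]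
    using C 2 3 by (simp add: deloop2_def deloop_nfun_def)
qed

section \<open>Homotopy groups and induced maps in terms of \<open>endo\<close>\<close>

lemma
  assumes C: "strict_groupoid 3 C" and c: "c \<in> ob C"
  defines "G \<equiv> hom_cat (hom_cat C c c) (idn C c) (idn C c)"
  shows pi0_rel_endo: "pi0_rel (Suc 0) G = isom_rel (endo C c)"
    and endo_invertible: "\<lbrakk>u \<in> Obj (endo C c); v \<in> Obj (endo C c); f \<in> Hom (endo C c) u v\<rbrakk>
      \<Longrightarrow> \<exists>g. inverse_homs (endo C c) u v f g"
proof -
  interpret comm_moncat "endo C c"
    using C c by (intro comm_moncat_endo strict_groupoid_imp_cat)
  have "idn C c \<in> ob (hom_cat C c c)"
    using C c by (simp add: numeral_3_eq_3)
  then have G: "groupoid (tau1 1 G)"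
    using C c by (simp add: numeral_3_eq_3 G_def)
  have match: "Obj (endo C c) = ob G" "\<And>u v. Hom (endo C c) u v = ob (hom_cat G u v)"
    "\<And>u v w f g. Comp (endo C c) u v w f g = fob (cmp G u v w) (f, g)" "Id (endo C c) = idn G"
    by (simp_all add: endo_def Let_def G_def)
  show "pi0_rel (Suc 0) G = isom_rel (endo C c)"
    by (rule pi0_rel_eq_isom_rel(1)[OF match, unfolded One_nat_def]) auto
  show "\<exists>g. inverse_homs (endo C c) u v f g"
    if "u \<in> Obj (endo C c)" "v \<in> Obj (endo C c)" "f \<in> Hom (endo C c) u v"
    by (rule pi0_rel_eq_isom_rel(2)[OF match _ _ G that]) auto
qed

lemma homotopy_group_endo:
  assumes C: "strict_groupoid 3 C" "c \<in> ob C"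
  shows "homotopy_group 3 2 C c = pi2 (endo C c)"
    and "homotopy_group 3 3 C c = pi3 (endo C c)"
  using pi0_rel_endo[OF C]
  by (simp_all add: numeral_3_eq_3 numeral_2_eq_2 pi2_def pi3_def endo_def Let_def pi0_def tau1_def
      Defs.truncate_def quotient_Id_on)

lemma homotopy_group_deloop:
  assumes "picard M"
  shows "homotopy_group 3 2 (deloop2 s M) s = pi2 M"
    and "homotopy_group 3 3 (deloop2 s M) s = pi3 M"
proof -
  have "s \<in> ob (deloop2 s M)"
    by (simp add: deloop2_def)
  from homotopy_group_endo[OF strict_groupoid_deloop(3)[OF assms] this]
  show "homotopy_group 3 2 (deloop2 s M) s = pi2 M" "homotopy_group 3 3 (deloop2 s M) s = pi3 M"
    by (simp_all add: endo_deloop2)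
qed

lemma homotopy_map_deloop_nfun:
  assumes C: "strict_groupoid 3 C" "c \<in> ob C"
  shows "homotopy_map 3 2 (deloop2 s M) C (deloop_nfun c (idn C c) \<Phi> \<Psi>) s =
      (\<lambda>X. \<Union>u\<in>X. isom_rel (endo C c) `` {\<Phi> u})"
    and "homotopy_map 3 3 (deloop2 s M) C (deloop_nfun c (idn C c) \<Phi> \<Psi>) s =
      (\<lambda>X. \<Union>f\<in>X. Id_on (Hom (endo C c) (\<Phi> (Zero M)) (\<Phi> (Zero M))) `` {\<Psi> (Zero M) (Zero M) f})"
  using pi0_rel_endo[OF C]
  by (simp_all add: fun_eq_iff numeral_3_eq_3 numeral_2_eq_2 pi0_map_def deloop_nfun_def deloop2_def
      deloop1_def)
    (simp_all add: endo_def Let_def)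

text \<open>The composite need not equal \<open>F\<close> as raw data, but it takes the same
  values.\<close>

lemma homotopy_map_fun_comp_id:
  "homotopy_map 3 3 A C (fun_comp 3 F (fun_id 3)) a = homotopy_map 3 3 A C F a"
  by (simp add: numeral_3_eq_3 pi0_map_def fun_eq_iff)

lemma iso_trivial_groups:
  assumes "trivial_group G" "trivial_group H" "\<And>x. x \<in> carrier G \<Longrightarrow> f x \<in> carrier H"
  shows "f \<in> iso G H"
proof -
  interpret G: group G using assms by (simp add: trivial_group_def)
  interpret H: group H using assms by (simp add: trivial_group_def)
  have "f \<one>\<^bsub>G\<^esub> = \<one>\<^bsub>H\<^esub>"
    using assms by (auto simp: trivial_group_def)
  then show ?thesis
    using assms(1,2) by (auto simp: trivial_group_def iso_def hom_def bij_betw_def)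
qed

text \<open>One statement for both morphisms: \<open>F\<close> is the identity for \<open>g\<close>
  and \<open>collapse (0, 0) (0, 0)\<close> for \<open>h\<close>.\<close>

lemma (in comm_moncat) pi3_iso:
  assumes "\<And>f. f \<in> Hom M (Zero M) (Zero M) \<Longrightarrow> F f = f"
  shows "(\<lambda>X. \<Union>f\<in>X. Id_on (Hom M (Zero M) (Zero M)) `` {F f}) \<in> iso (pi3 M) (pi3 M)" (is "?F \<in> _")
proof -
  have F: "?F X = X" if "X \<in> carrier (pi3 M)" for X
    using that by (auto simp: pi3_def assms Id_on_Image_singleton)
  moreover have "X \<otimes>\<^bsub>pi3 M\<^esub> Y \<in> carrier (pi3 M)" if "X \<in> carrier (pi3 M)" "Y \<in> carrier (pi3 M)" for X Y
    using that by (auto simp: pi3_def Id_on_Image_singleton)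
  ultimately have "?F \<in> hom (pi3 M) (pi3 M)"
    unfolding hom_def by (auto simp del: UN_simps)
  moreover have "bij_betw ?F (carrier (pi3 M)) (carrier (pi3 M))"
    by (rule bij_betw_byWitness[where f' = "\<lambda>X. X"]) (use F in auto)
  ultimately show ?thesis
    by (simp add: iso_def)
qed

lemma (in comm_moncat) picard_End_Zero:
  assumes "\<And>f. f \<in> Hom M (Zero M) (Zero M) \<Longrightarrow> \<exists>g. inverse_homs M (Zero M) (Zero M) f g"
  shows "picard (M\<lparr>Obj := {Zero M}\<rparr>)"
proof -
  interpret N: comm_moncat "M\<lparr>Obj := {Zero M}\<rparr>"
    by (rule comm_moncat_End_Zero)
  show ?thesis
  proof unfold_locales
    show "\<exists>g. inverse_homs (M\<lparr>Obj := {Zero M}\<rparr>) u v f g"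
      if "u \<in> Obj (M\<lparr>Obj := {Zero M}\<rparr>)" "v \<in> Obj (M\<lparr>Obj := {Zero M}\<rparr>)"
        "f \<in> Hom (M\<lparr>Obj := {Zero M}\<rparr>) u v" for u v f
      using assms[of f] that by (simp add: inverse_homs_def)
    show "\<exists>w\<in>Obj (M\<lparr>Obj := {Zero M}\<rparr>).
        (Add (M\<lparr>Obj := {Zero M}\<rparr>) u w, Zero (M\<lparr>Obj := {Zero M}\<rparr>)) \<in> isom_rel (M\<lparr>Obj := {Zero M}\<rparr>)"
      if "u \<in> Obj (M\<lparr>Obj := {Zero M}\<rparr>)" for u
      using that equiv_class_self[OF N.equiv_isom_rel, of "Zero M"] by simp
  qed
qed

section \<open>The category of words and its two monoidal functors\<close>

context generating_pair
begin

lemma picard_words: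
  assumes j: "inj j"
    and inv: "\<And>u v f. \<lbrakk>u \<in> Obj M; v \<in> Obj M; f \<in> Hom M u v\<rbrakk> \<Longrightarrow> \<exists>g. inverse_homs M u v f g"
  shows "picard (words j)"
proof -
  interpret W: comm_moncat "words j"
    using j by (rule comm_moncat_words)
  show ?thesis
  proof unfold_locales
    show "\<exists>g. inverse_homs (words j) u v f g"
      if "u \<in> Obj (words j)" "v \<in> Obj (words j)" "f \<in> Hom (words j) u v" for u v f
      using inv[OF val_in val_in, of f "inv_into UNIV j u" "inv_into UNIV j v"] that
      by (simp add: inverse_homs_def words_def del: val.simps)
    show "\<exists>w\<in>Obj (words j). (Add (words j) u w, Zero (words j)) \<in> isom_rel (words j)"
      if "u \<in> Obj (words j)" for u
    proof -
      obtain p where p: "u = j p"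
        using \<open>u \<in> Obj (words j)\<close> by (auto simp: words_def)
      \<comment> \<open>The weak inverse of \<open>(m, n)\<close> is \<open>(n, m)\<close>: the sum
        is \<open>(k, k)\<close> with value \<open>k (x + y)\<close>, isomorphic to \<open>0\<close>
        by \<open>pull k\<close>.\<close>
      let ?k = "fst p + snd p"
      have "inverse_homs M (diag ?k) (Zero M) (pull ?k) (push ?k)"
        using inverse_push_pull by (simp add: inverse_homs_def)
      then have "(diag ?k, Zero M) \<in> isom_rel M"
        by (auto simp: isom_rel_def)
      then have "(val (?k, ?k), val (0, 0)) \<in> isom_rel M"
        unfolding val_diag by simp
      then have "(j (?k, ?k), j (0, 0)) \<in> isom_rel (words j)"
        unfolding isom_rel_words[OF j] .
      moreover have "Add (words j) u (j (prod.swap p)) = j (?k, ?k)" "Zero (words j) = j (0, 0)"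
        by (simp_all add: words_def p inv_f_f[OF j] add.commute)
      moreover have "j (prod.swap p) \<in> Obj (words j)"
        by (simp add: words_def)
      ultimately show ?thesis by metis
    qed
  qed
qed

lemma monoidal_functor_val:
  assumes j: "inj j"
  shows "monoidal_functor (words j) M (\<lambda>u. val (inv_into UNIV j u)) (\<lambda>u v f. f)"
proof -
  interpret W: comm_moncat "words j"
    using j by (rule comm_moncat_words)
  show ?thesis
    by unfold_locales (auto simp: words_def inv_f_f[OF j] val_plus simp del: val.simps)
qed

lemma monoidal_functor_collapse:
  assumes j: "inj j"
  shows "monoidal_functor (words j) (M\<lparr>Obj := {Zero M}\<rparr>) (\<lambda>_. Zero M)
    (\<lambda>u v f. collapse (inv_into UNIV j u) (inv_into UNIV j v) f)"
proof -
  interpret W: comm_moncat "words j"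
    using j by (rule comm_moncat_words)
  interpret N: comm_moncat "M\<lparr>Obj := {Zero M}\<rparr>"
    by (rule comm_moncat_End_Zero)
  show ?thesis
    by unfold_locales
      (auto simp: words_def inv_f_f[OF j] collapse_in collapse_Id collapse_Comp collapse_Addh
        simp del: val.simps)
qed

text \<open>The unit \<open>(0, 0)\<close> has value exactly \<open>0\<close>, so its endomorphisms
  are those of \<open>0\<close> in \<open>M\<close>.\<close>

lemma pi3_words: "inj j \<Longrightarrow> pi3 (words j) = pi3 M"
  by (simp add: pi3_def words_def inv_f_f)

end

section \<open>The diagram\<close>

theorem proposition5p3:
  fixes C :: "'u ncat" and c :: 'u
    and H :: "('h, 'e) monoid_scheme" and \<phi> :: "'u set \<Rightarrow> 'h"
  assumes "strict_groupoid 3 C" and "c \<in> ob C"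
    and "is_singleton (pi0 3 C)"
    and "trivial_group (homotopy_group 3 1 C c)"
    and "homotopy_group 3 2 C c \<cong> integer_group"
    and "comm_group H"
    and "\<phi> \<in> iso (homotopy_group 3 3 C c) H"
  shows "\<exists>(B :: 'u ncat) (A :: 'u ncat) (D :: 'u ncat)
           (g :: ('u, 'u) nfun) (f :: ('u, 'u) nfun) (h :: ('u, 'u) nfun) b a d.
           strict_groupoid 3 B \<and> strict_groupoid 3 A \<and> strict_groupoid 3 D \<and>
           strict_functor 3 B C g \<and> strict_functor 3 A B f \<and> strict_functor 3 A D h \<and>
           b \<in> ob B \<and> a \<in> ob A \<and> d \<in> ob D \<and>
           fob f a = b \<and> fob g b = c \<and> fob h a = d \<and>
           strict_equivalence 3 B C g \<and> strict_equivalence 3 A B f \<and>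
           is_singleton (pi0 3 D) \<and>
           trivial_group (homotopy_group 3 1 D d) \<and>
           trivial_group (homotopy_group 3 2 D d) \<and>
           \<phi> \<circ> homotopy_map 3 3 A C (fun_comp 3 g f) a \<in> iso (homotopy_group 3 3 A a) H \<and>
           homotopy_map 3 3 A D h a \<in> iso (homotopy_group 3 3 A a) (homotopy_group 3 3 D d)"
proof -
  note C = assms(1,2)
  have catC: "strict_cat 3 C"
    using C(1) by (rule strict_groupoid_imp_cat)
  define M where "M = endo C c"
  let ?R = "isom_rel M"
  interpret M: comm_moncat M
    unfolding M_def using catC C(2) by (rule comm_moncat_endo)
  have inv: "\<exists>g. inverse_homs M u v f g" if "u \<in> Obj M" "v \<in> Obj M" "f \<in> Hom M u v" for u v f
    using endo_invertible[OF C] that by (simp add: M_def)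
  have pi2C: "homotopy_group 3 2 C c = pi2 M" and pi3C: "homotopy_group 3 3 C c = pi3 M"
    using homotopy_group_endo[OF C] by (simp_all add: M_def)

  \<comment> \<open>The degree, and the choice of \<open>x\<close> and \<open>y\<close>\<close>
  obtain \<theta> where \<theta>: "\<theta> \<in> iso (pi2 M) integer_group"
    using assms(5) unfolding is_iso_def pi2C by blast
  interpret \<theta>: group_hom "pi2 M" integer_group \<theta>
    using \<theta> homotopy_group_group[OF C, of 2] group_integer_group
    unfolding pi2C by (simp add: group_hom_def group_hom_axioms_def iso_def)
  \<comment> \<open>The integer attached to the class of \<open>u\<close>; it is additive, and equal
    degrees mean isomorphic objects.\<close>
  define deg where "deg u = \<theta> (?R `` {u})" for u
  have class_in: "?R `` {u} \<in> carrier (pi2 M)" if "u \<in> Obj M" for u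
    using that by (simp add: pi2_def quotientI)
  have deg_Add: "deg (Add M u v) = deg u + deg v" if "u \<in> Obj M" "v \<in> Obj M" for u v
    using \<theta>.hom_mult[OF class_in[OF that(1)] class_in[OF that(2)]] M.UN_class_Add[OF that]
    by (simp add: deg_def pi2_def)
  have deg_Zero: "deg (Zero M) = 0"
    using \<theta>.hom_one by (simp add: deg_def pi2_def)
  have deg_mult: "deg (M.mult n u) = int n * deg u" if "u \<in> Obj M" for n u
    using that by (induction n) (simp_all add: deg_Zero deg_Add algebra_simps)
  have inj_\<theta>: "inj_on \<theta> (carrier (pi2 M))"
    using \<theta> by (simp add: iso_def bij_betw_def)
  have deg_eq_iff: "deg u = deg v \<longleftrightarrow> (u, v) \<in> ?R" if "u \<in> Obj M" "v \<in> Obj M" for u v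
    using that inj_on_eq_iff[OF inj_\<theta> class_in class_in] eq_equiv_class_iff[OF M.equiv_isom_rel]
    by (simp add: deg_def)
  have surj: "\<exists>u\<in>Obj M. deg u = k" for k
  proof -
    have "k \<in> \<theta> ` carrier (pi2 M)"
      using \<theta> by (simp add: iso_def bij_betw_def)
    then show ?thesis
      by (auto simp: pi2_def deg_def elim!: quotientE)
  qed
  obtain x where x: "x \<in> Obj M" "deg x = 1" using surj by blast
  obtain y where y: "y \<in> Obj M" "deg y = - 1" using surj by blast
  \<comment> \<open>Both objects have degree 0.\<close>
  have "(Zero M, Add M x y) \<in> ?R"
    using x y by (subst deg_eq_iff[symmetric]) (auto simp: deg_Zero deg_Add)
  then obtain \<iota> \<kappa> where "inverse_homs M (Zero M) (Add M x y) \<iota> \<kappa>"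
    by (auto simp: isom_rel_def)
  then interpret W: weak_inverse_pair M x y \<iota> \<kappa>
    using x y by unfold_locales
  have deg_val: "deg (W.val p) = int (fst p) - int (snd p)" for p
    using x y by (cases p) (simp add: deg_Add deg_mult)
  \<comment> \<open>Every arrow of \<open>M\<close> is invertible, so its ends are isomorphic and
    have equal degree \<open>m - n\<close>.\<close>
  interpret G: generating_pair M x y \<iota> \<kappa>
  proof unfold_locales
    fix f p q
    assume "f \<in> Hom M (W.val p) (W.val q)"
    then have "(W.val p, W.val q) \<in> ?R"
      using inv[of "W.val p" "W.val q" f] by (auto simp: isom_rel_def simp del: W.val.simps)
    then have "deg (W.val p) = deg (W.val q)"
      by (subst deg_eq_iff) auto
    then show "fst p + snd q = snd p + fst q"
      unfolding deg_val by linarith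
  qed

  \<comment> \<open>The type \<open>'u\<close> must have room for all pairs: the multiples of
    \<open>x\<close> are distinct because \<open>n x\<close> has degree \<open>n\<close>, so they
    can code the natural numbers, and \<open>prod_encode\<close> reduces pairs to these.\<close>
  define j where "j = (\<lambda>n. M.mult n x) \<circ> prod_encode"
  have "inj (\<lambda>n. M.mult n x)"
    using deg_mult[OF x(1)] x(2) by (intro injI) (metis mult.right_neutral of_nat_eq_iff)
  then have j: "inj j"
    unfolding j_def by (intro inj_compose inj_prod_encode)

  \<comment> \<open>The groupoids \<open>A\<close>, \<open>D\<close> and the morphisms
    \<open>g\<close>, \<open>h\<close>\<close>
  let ?W = "G.words j" and ?E = "M\<lparr>Obj := {Zero M}\<rparr>"
  let ?v = "\<lambda>u. W.val (inv_into UNIV j u)"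
  \<comment> \<open>Taking \<open>c\<close> as the object of both deloopings makes all base points
    equal to \<open>c\<close>.\<close>
  let ?A = "deloop2 c ?W" and ?D = "deloop2 c ?E"
  let ?g = "deloop_nfun c (idn C c) ?v (\<lambda>u v f. f)"
  let ?h = "deloop_nfun c c (\<lambda>_. Zero M) (\<lambda>u v f. W.collapse (inv_into UNIV j u) (inv_into UNIV j v) f)"
  have picW: "picard ?W"
    using j inv by (rule G.picard_words)
  have picE: "picard ?E"
    using inv by (intro M.picard_End_Zero) auto
  interpret W': picard ?W by (rule picW)
  interpret E: picard ?E by (rule picE)
  have A: "strict_groupoid 3 ?A" and D: "strict_groupoid 3 ?D"
    by (rule strict_groupoid_deloop(3)[OF picW], rule strict_groupoid_deloop(3)[OF picE])
  have cA: "c \<in> ob ?A" and cD: "c \<in> ob ?D" and idnD: "idn ?D c = c"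
    by (simp_all add: deloop2_def)
  have pi3E: "pi3 ?E = pi3 M"
    by (simp add: pi3_def)
  have g: "strict_functor 3 ?A C ?g"
    using catC C(2) G.monoidal_functor_val[OF j] unfolding M_def by (rule strict_functor_deloop)
  have h: "strict_functor 3 ?A ?D ?h"
    using strict_functor_deloop[OF strict_groupoid_imp_cat[OF D] cD, unfolded endo_deloop2 idnD]
      G.monoidal_functor_collapse[OF j] by blast

  \<comment> \<open>\<open>g\<close> is an equivalence\<close>
  have map3g: "homotopy_map 3 3 ?A C ?g c \<in> iso (homotopy_group 3 3 ?A c) (homotopy_group 3 3 C c)"
  proof -
    \<comment> \<open>\<open>g\<close> preserves the unit strictly and fixes 3-cells, so its effect
      on the third homotopy group is the identity.\<close>
    have Zero: "?v (Zero ?W) = Zero M"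
      by (simp add: G.words_def inv_f_f[OF j])
    show ?thesis
      using M.pi3_iso[of "\<lambda>f. f"]
      unfolding homotopy_map_deloop_nfun[OF C] homotopy_group_deloop[OF picW] pi3C G.pi3_words[OF j]
        M_def[symmetric] Zero by (simp only: simp_thms)
  qed
  have map2g: "homotopy_map 3 2 ?A C ?g c \<in> iso (homotopy_group 3 2 ?A c) (homotopy_group 3 2 C c)"
  proof -
    let ?F = "\<lambda>X. \<Union>u\<in>X. ?R `` {?v u}"
    \<comment> \<open>Words have all arrows of \<open>M\<close> between their values, so isomorphism
      is the same on both sides; this gives both the well-definedness of \<open>?F\<close> on
      classes and its injectivity.\<close>
    have rel: "(u, v) \<in> isom_rel ?W \<longleftrightarrow> (?v u, ?v v) \<in> ?R" if "u \<in> Obj ?W" "v \<in> Obj ?W" for u v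
      using that G.isom_rel_words[OF j] by (auto simp: G.words_def inv_f_f[OF j] simp del: W.val.simps)
    have F: "?F (isom_rel ?W `` {u}) = ?R `` {?v u}" if u: "u \<in> Obj ?W" for u
    proof -
      have "?R `` {?v v} = ?R `` {?v u}" if "v \<in> isom_rel ?W `` {u}" for v
      proof -
        have "v \<in> Obj ?W" "(u, v) \<in> isom_rel ?W"
          using that by (auto simp: isom_rel_def)
        then have "(?v u, ?v v) \<in> ?R"
          using rel[OF u] by blast
        then show ?thesis
          using equiv_class_eq[OF M.equiv_isom_rel] by metis
      qed
      moreover have "u \<in> isom_rel ?W `` {u}"
        using equiv_class_self[OF W'.equiv_isom_rel u] .
      ultimately show ?thesis by blast
    qed
    have v_in: "?v u \<in> Obj M" for u
      by (rule W.val_in)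
    have v_Add: "?v (Add ?W u v) = Add M (?v u) (?v v)" for u v
      by (simp add: G.words_def inv_f_f[OF j] W.val_padd del: W.val.simps)
    have "?F \<in> hom (pi2 ?W) (pi2 M)"
    proof (rule homI)
      fix X Y
      assume "X \<in> carrier (pi2 ?W)" "Y \<in> carrier (pi2 ?W)"
      then obtain u v where u: "u \<in> Obj ?W" "X = isom_rel ?W `` {u}"
        and v: "v \<in> Obj ?W" "Y = isom_rel ?W `` {v}"
        by (auto simp: pi2_def elim!: quotientE)
      show "?F X \<in> carrier (pi2 M)"
        unfolding u(2) F[OF u(1)] by (rule class_in[OF v_in])
      have "X \<otimes>\<^bsub>pi2 ?W\<^esub> Y = isom_rel ?W `` {Add ?W u v}"
        using W'.UN_class_Add u v by (simp add: pi2_def)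
      moreover have "?R `` {?v u} \<otimes>\<^bsub>pi2 M\<^esub> ?R `` {?v v} = ?R `` {Add M (?v u) (?v v)}"
        using M.UN_class_Add[OF v_in v_in] by (simp add: pi2_def del: W.val.simps)
      ultimately show "?F (X \<otimes>\<^bsub>pi2 ?W\<^esub> Y) = ?F X \<otimes>\<^bsub>pi2 M\<^esub> ?F Y"
        using F[OF W'.Add_in[OF u(1) v(1)]] F[OF u(1)] F[OF v(1)] u(2) v(2) v_Add by metis
    qed
    moreover have "inj_on ?F (carrier (pi2 ?W))"
    proof (rule inj_onI)
      fix X Y
      assume "X \<in> carrier (pi2 ?W)" "Y \<in> carrier (pi2 ?W)" and eq: "?F X = ?F Y"
      then obtain u v where u: "u \<in> Obj ?W" "X = isom_rel ?W `` {u}"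
        and v: "v \<in> Obj ?W" "Y = isom_rel ?W `` {v}"
        by (auto simp: pi2_def elim!: quotientE)
      have "?R `` {?v u} = ?R `` {?v v}"
        using eq F[OF u(1)] F[OF v(1)] u(2) v(2) by metis
      then have "(?v u, ?v v) \<in> ?R"
        using eq_equiv_class_iff[OF M.equiv_isom_rel v_in v_in] by blast
      then have "(u, v) \<in> isom_rel ?W"
        using rel[OF u(1) v(1)] by blast
      then show "X = Y"
        unfolding u(2) v(2) by (rule equiv_class_eq[OF W'.equiv_isom_rel])
    qed
    moreover have "X \<in> ?F ` carrier (pi2 ?W)" if X: "X \<in> carrier (pi2 M)" for X
    proof -
      obtain u where u: "u \<in> Obj M" "X = ?R `` {u}"
        using X by (auto simp: pi2_def elim!: quotientE)
      \<comment> \<open>Since \<open>nat\<close> sends negative integers to 0, one entry vanishes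
        and \<open>m - n\<close> is the degree of \<open>u\<close> for either sign.\<close>
      define p where "p = (nat (deg u), nat (- deg u))"
      have "deg (W.val p) = deg u"
        unfolding deg_val by (simp add: p_def)
      then have "(W.val p, u) \<in> ?R"
        using deg_eq_iff[OF W.val_in u(1)] by blast
      then have "X = ?R `` {?v (j p)}"
        unfolding u(2) inv_f_f[OF j] using equiv_class_eq[OF M.equiv_isom_rel] by metis
      moreover have jp: "j p \<in> Obj ?W"
        by (simp add: G.words_def)
      ultimately have "X = ?F (isom_rel ?W `` {j p})"
        using F[OF jp] by simp
      then show ?thesis
        using jp by (intro image_eqI) (auto simp: pi2_def quotientI)
    qed
    ultimately have "?F \<in> iso (pi2 ?W) (pi2 M)"
      unfolding iso_def bij_betw_def hom_def by blast
    then show ?thesis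
      unfolding homotopy_map_deloop_nfun[OF C] homotopy_group_deloop[OF picW] pi2C M_def[symmetric] .
  qed
  have map1g: "homotopy_map 3 1 ?A C ?g c \<in> iso (homotopy_group 3 1 ?A c) (homotopy_group 3 1 C c)"
  \<comment> \<open>Both groups are trivial, so only membership in the carrier is left.\<close>
  proof (rule iso_trivial_groups[OF homotopy_deloop(3)[OF picW] assms(4)])
    fix X
    assume "X \<in> carrier (homotopy_group 3 1 ?A c)"
    then have "X = {c}"
      using homotopy_deloop(2)[OF picW, of c] by (simp add: deloop2_def)
    moreover have "idn C c \<in> ob (hom_cat C c c)"
      using catC C(2) by (simp add: numeral_3_eq_3)
    ultimately show "homotopy_map 3 1 ?A C ?g c X \<in> carrier (homotopy_group 3 1 C c)"
      by (simp add: deloop_nfun_def pi0_map_def pi0_def quotientI)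
  qed
  have map0g: "bij_betw (pi0_map 3 C ?g) (pi0 3 ?A) (pi0 3 C)"
  proof -
    have "pi0_map 3 C ?g {c} \<in> pi0 3 C"
      using C(2) by (simp add: deloop_nfun_def pi0_map_def pi0_def quotientI)
    then have "pi0 3 C = {pi0_map 3 C ?g {c}}"
      using assms(3) by (auto simp: is_singleton_def)
    then show ?thesis
      unfolding homotopy_deloop(1)[OF picW] by (simp add: bij_betw_def)
  qed
  have "strict_equivalence 3 ?A C ?g"
    unfolding strict_equivalence_def
  proof (intro conjI ballI)
    fix a i
    assume "a \<in> ob ?A" and "i \<in> {1..3::nat}"
    then have "a = c" and "i = 1 \<or> i = 2 \<or> i = 3"
      by (auto simp: deloop2_def)
    moreover have "fob ?g c = c"
      by (simp add: deloop_nfun_def)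
    ultimately show "homotopy_map 3 i ?A C ?g a \<in> iso (homotopy_group 3 i ?A a)
        (homotopy_group 3 i C (fob ?g a))"
      using map1g map2g map3g by metis
  qed (fact g map0g)+

  \<comment> \<open>The identity \<open>f\<close>, the homotopy of \<open>D\<close>, and the maps on
    the third homotopy group\<close>
  moreover have "strict_equivalence 3 ?A ?A (fun_id 3)" "strict_functor 3 ?A ?A (fun_id 3)"
    using strict_equivalence_id[OF A] by (auto simp: strict_equivalence_def)
  moreover have "is_singleton (pi0 3 ?D)"
    by (simp add: homotopy_deloop(1)[OF picE])
  moreover have "trivial_group (homotopy_group 3 1 ?D c)"
    by (rule homotopy_deloop(3)[OF picE])
  moreover have "trivial_group (homotopy_group 3 2 ?D c)"
  proof -
    have grp: "group (pi2 ?E)"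
      using homotopy_group_group[OF D cD, of 2] by (simp add: homotopy_group_deloop[OF picE])
    \<comment> \<open>\<open>0\<close> is the only object of \<open>?E\<close>, hence represents the
      only class.\<close>
    have "carrier (pi2 ?E) = {isom_rel ?E `` {Zero M}}"
      by (simp add: pi2_def quotient_def)
    then show ?thesis
      unfolding homotopy_group_deloop[OF picE] trivial_group_def using grp by (simp add: pi2_def)
  qed
  moreover have "\<phi> \<circ> homotopy_map 3 3 ?A C (fun_comp 3 ?g (fun_id 3)) c
      \<in> iso (homotopy_group 3 3 ?A c) H"
    unfolding homotopy_map_fun_comp_id using map3g assms(7) by (rule iso_set_trans)
  moreover have "homotopy_map 3 3 ?A ?D ?h c \<in> iso (homotopy_group 3 3 ?A c) (homotopy_group 3 3 ?D c)"
  proof -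
    \<comment> \<open>Only arrows from the unit \<open>(0, 0)\<close> to itself enter, and there
      \<open>collapse\<close> is the identity.\<close>
    have "homotopy_map 3 3 ?A ?D ?h c =
      (\<lambda>X. \<Union>f\<in>X. Id_on (Hom M (Zero M) (Zero M)) `` {W.collapse (0, 0) (0, 0) f})"
      using homotopy_map_deloop_nfun(2)[OF D cD, unfolded endo_deloop2 idnD, of c ?W]
      by (simp add: G.words_def inv_f_f[OF j])
    then show ?thesis
      using M.pi3_iso[OF W.collapse_zero]
      unfolding homotopy_group_deloop[OF picW] homotopy_group_deloop[OF picE]
        pi3E G.pi3_words[OF j] by simp
  qed
  moreover have "fob (fun_id 3) c = c" "fob ?g c = c" "fob ?h c = c"
    by (simp_all add: deloop_nfun_def)
  ultimately show ?thesis
    using A D g h cA cD by blast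
qed

end
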